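(* Let $A$, $x_0,x^\dagger\in X$, the data $z^\delta=Ax^\dagger+\delta\zeta$, and the regularization $(g_\alpha)_{\alpha>0}$ be as in the context, and fix $\alpha_0>0$, $0<q<1$, $\tau>1$, $\eta>0$. Suppose that there exist $c_1>1$, $0<c_2<1$ and $0<t_0<\|A\|$ such that $$\int_0^\alpha d\|E_t(x^\dagger-x_0)\|^2\le c_1^2\int_{c_2\alpha}^\infty r_\alpha^2(t)\,d\|E_t(x^\dagger-x_0)\|^2\qquad\text{for all }0<\alpha\le t_0 .$$ Suppose also that the noise $\zeta\in X$ satisfies the following: there is a function $\alpha\mapsto\delta(\alpha)>0$ on $(0,\infty)$ that is non-decreasing, with $\alpha\mapsto\delta(\alpha)/\sqrt\alpha$ non-increasing, such that $\delta\|s_\alpha^{1/2}(A)\zeta\|\le\delta(\alpha)$ for all $\alpha\in\Delta_q$ with $\alpha\ge\hat\alpha$, where $\hat\alpha\in\Delta_q$ is the largest parameter with $\hat\alpha\le\eta\,\delta(\hat\alpha)$. Let $\alpha_*$ be chosen by the RG-rule (see the context) starting with $\alpha_0$. Then there is a constant $C$, independent of $\delta$, $\zeta$ and the function $\delta(\cdot)$, such that $$\|x_{\alpha_*}^\delta-x^\dagger\|\le C\inf_{0<\alpha\le\alpha_0}\left\{\|x_\alpha-x^\dagger\|+\frac{\delta(\alpha)}{\alpha}\right\}.$$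
   Context: **Setting.** $X,Y$ are Hilbert spaces, $T\colon X\to Y$ a nonzero compact linear operator, $A:=T^*T$ (compact, self-adjoint, non-negative on $X$). $x^\dagger\in X$ is the solution, $\delta>0$, $\zeta\in X$ is a (deterministic) noise element, $z:=Ax^\dagger$, $z^\delta:=Ax^\dagger+\delta\zeta$. $\Delta_q:=\{q^k\alpha_0:k=0,1,2,\dots\}$, and $s_\alpha(t):=\alpha/(t+\alpha)$ for $t\ge0$, $\alpha>0$. **Regularization.** A family of functions $g_\alpha\colon[0,\|A\|]\to\mathbb R$, $\alpha>0$, piecewise continuous in $\alpha$, with residual functions $r_\alpha(t):=1-t\,g_\alpha(t)$, such that: (i) for each $0<t\le\|A\|$, $|r_\alpha(t)|\to0$ as $\alpha\to0$; (ii) there is $\gamma_*\ge1$ with $\sup_{0\le t\le\|A\|}\alpha|g_\alpha(t)|\le\gamma_*$ for all $\alpha>0$; (iii) $r_\alpha(t)\le r_\beta(t)$ for $0<\alpha\le\beta$; (iv) $0\le r_\alpha(t)\le1$ for $\alpha>0$. With the initial guess $x_0\in X$ put $x_\alpha^\delta:=x_0-g_\alpha(A)(Ax_0-z^\delta)$ and $x_\alpha:=x_0-g_\alpha(A)(Ax_0-z)$. **RG-rule.** Given $\tau>1$ and $\eta>0$, $\alpha_*\in\Delta_q$ is the largest parameter such that $\alpha_*\ge\hat\alpha$ and $\|s_{\alpha_*}(A)(Ax_{\alpha_*}^\delta-z^\delta)\|\le\tau\,\delta(\alpha_* )$; if no such parameter exists, $\alpha_*:=\hat\alpha$. **Spectral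 integrals.** $(E_t)$ is the spectral resolution of $A$; integrals $\int_a^b f(t)\,d\|E_tw\|^2$ are integrals over $[a,b)$ with respect to the spectral measure $B\mapsto\|1_B(A)w\|^2$ (so $\int_0^\alpha d\|E_tw\|^2=\|1_{[0,\alpha)}(A)w\|^2$). *)

theory Defs
  imports "HOL-Analysis.Analysis"
begin

text \<open>Hilbert spaces are types of class real_inner and complete_space, without any assumption
  on separability or dimension.\<close>

definition compact_operator :: "('a::real_normed_vector \<Rightarrow> 'b::real_normed_vector) \<Rightarrow> bool" where
  "compact_operator T \<longleftrightarrow> bounded_linear T \<and> compact (closure (T ` cball 0 1))"

subsection \<open>Spectral calculus of a compact self-adjoint operator\<close>

definition eigenspace :: "('a::real_inner \<Rightarrow> 'a) \<Rightarrow> real \<Rightarrow> 'a set" where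
  "eigenspace A l = {v. A v = l *\<^sub>R v}"

definition eigenvalues :: "('a::real_inner \<Rightarrow> 'a) \<Rightarrow> real set" where
  "eigenvalues A = {l. \<exists>v. v \<noteq> 0 \<and> A v = l *\<^sub>R v}"

definition orth_proj :: "'a::real_inner set \<Rightarrow> 'a \<Rightarrow> 'a" where
  "orth_proj S w = (THE p. p \<in> S \<and> (\<forall>v\<in>S. (w - p) \<bullet> v = 0))"

text \<open>For compact self-adjoint \<open>A\<close> the space is the orthogonal Hilbert sum of the eigenspaces,
  and the spectral resolution is carried by the eigenvalues:
  \<open>f(A) w = \<integral> f(t) dE_t w = \<Sum> f(l) P_l w\<close>, with \<open>P_l\<close> the orthogonal projection onto
  the eigenspace of \<open>l\<close>.  The eigenvalue \<open>0\<close> (the kernel of \<open>A\<close>) takes part in the sum.  The sum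
  converges unconditionally in norm whenever \<open>f\<close> is bounded on the eigenvalues; the values of \<open>f\<close>
  elsewhere are irrelevant.\<close>

definition fun_calc :: "('a::real_inner \<Rightarrow> 'a) \<Rightarrow> (real \<Rightarrow> real) \<Rightarrow> 'a \<Rightarrow> 'a" where
  "fun_calc A f w = (\<Sum>\<^sub>\<infinity>l\<in>eigenvalues A. f l *\<^sub>R orth_proj (eigenspace A l) w)"

definition spectral_projection :: "('a::real_inner \<Rightarrow> 'a) \<Rightarrow> real set \<Rightarrow> 'a \<Rightarrow> 'a" where
  "spectral_projection A B = fun_calc A (indicator B)"

text \<open>The measure \<open>d\<parallel>E_t w\<parallel>\<^sup>2\<close>.  Being concentrated on the countably many eigenvalues with
  nonzero component of \<open>w\<close>, it is defined on all sets of reals, so that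
  no measurability in \<open>t\<close> has to be required of the integrands.\<close>

definition spectral_measure :: "('a::real_inner \<Rightarrow> 'a) \<Rightarrow> 'a \<Rightarrow> real measure" where
  "spectral_measure A w =
     measure_of UNIV UNIV (\<lambda>B. ennreal ((norm (spectral_projection A B w))\<^sup>2))"

subsection \<open>Regularization\<close>

definition residual :: "(real \<Rightarrow> real \<Rightarrow> real) \<Rightarrow> real \<Rightarrow> real \<Rightarrow> real" where
  "residual g \<alpha> t = 1 - t * g \<alpha> t"

text \<open>Piecewise continuity on the open half-line: on every compact subinterval only finitely many
  discontinuities, all with one-sided limits.\<close>

definition piecewise_continuous_pos :: "(real \<Rightarrow> real) \<Rightarrow> bool" where
  "piecewise_continuous_pos f \<longleftrightarrow>
     (\<forall>a b. 0 < a \<longrightarrow> a < b \<longrightarrow>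
        (\<exists>S. finite S \<and> (\<forall>x\<in>{a..b} - S. isCont f x) \<and>
             (\<forall>x\<in>{a..b} \<inter> S. (\<exists>l. (f \<longlongrightarrow> l) (at_left x)) \<and> (\<exists>l. (f \<longlongrightarrow> l) (at_right x)))))"

text \<open>Here \<open>N\<close> is the operator norm of \<open>A\<close>; the values \<open>g \<alpha> t\<close> for \<open>t\<close> outside \<open>[0, N]\<close> or
  \<open>\<alpha> \<le> 0\<close> are unconstrained.\<close>

definition regularization :: "real \<Rightarrow> (real \<Rightarrow> real \<Rightarrow> real) \<Rightarrow> bool" where
  "regularization N g \<longleftrightarrow>
     (\<forall>t\<in>{0..N}. piecewise_continuous_pos (\<lambda>\<alpha>. g \<alpha> t)) \<and>
     (\<forall>t\<in>{0<..N}. ((\<lambda>\<alpha>. \<bar>residual g \<alpha> t\<bar>) \<longlongrightarrow> 0) (at_right 0)) \<and>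
     (\<exists>\<gamma>\<ge>1. \<forall>\<alpha>>0. \<forall>t\<in>{0..N}. \<alpha> * \<bar>g \<alpha> t\<bar> \<le> \<gamma>) \<and>
     (\<forall>\<alpha> \<beta>. 0 < \<alpha> \<longrightarrow> \<alpha> \<le> \<beta> \<longrightarrow> (\<forall>t\<in>{0..N}. residual g \<alpha> t \<le> residual g \<beta> t)) \<and>
     (\<forall>\<alpha>>0. \<forall>t\<in>{0..N}. 0 \<le> residual g \<alpha> t \<and> residual g \<alpha> t \<le> 1)"

text \<open>The regularized solution for data \<open>y\<close>; \<open>y\<close> is either the exact or the noisy right-hand
  side of \<open>A x = y\<close>.\<close>

definition reg_solution ::
    "('a::real_inner \<Rightarrow> 'a) \<Rightarrow> (real \<Rightarrow> real \<Rightarrow> real) \<Rightarrow> 'a \<Rightarrow> 'a \<Rightarrow> real \<Rightarrow> 'a" where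
  "reg_solution A g x0 y \<alpha> = x0 - fun_calc A (g \<alpha>) (A x0 - y)"

definition s_fun :: "real \<Rightarrow> real \<Rightarrow> real" where
  "s_fun \<alpha> t = \<alpha> / (t + \<alpha>)"

subsection \<open>Parameter choice\<close>

definition grid :: "real \<Rightarrow> real \<Rightarrow> real set" where
  "grid q \<alpha>0 = range (\<lambda>k::nat. q ^ k * \<alpha>0)"

text \<open>The noise bound \<open>\<delta>(\<cdot>)\<close> is written \<open>d\<close>.  The maximum below exists if \<open>d\<close> is positive and
  \<open>d \<alpha> / sqrt \<alpha>\<close> is non-increasing, since then \<open>\<alpha> / d \<alpha>\<close> tends to \<open>0\<close> with \<open>\<alpha>\<close>.\<close>

definition alpha_hat :: "real \<Rightarrow> real \<Rightarrow> real \<Rightarrow> (real \<Rightarrow> real) \<Rightarrow> real" where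
  "alpha_hat q \<alpha>0 \<eta> d = (GREATEST \<alpha>. \<alpha> \<in> grid q \<alpha>0 \<and> \<alpha> \<le> \<eta> * d \<alpha>)"

definition RG_admissible ::
    "('a::real_inner \<Rightarrow> 'a) \<Rightarrow> (real \<Rightarrow> real \<Rightarrow> real) \<Rightarrow> 'a \<Rightarrow> 'a \<Rightarrow>
     real \<Rightarrow> real \<Rightarrow> real \<Rightarrow> real \<Rightarrow> (real \<Rightarrow> real) \<Rightarrow> real set" where
  "RG_admissible A g x0 y q \<alpha>0 \<tau> \<eta> d =
     {\<alpha> \<in> grid q \<alpha>0. alpha_hat q \<alpha>0 \<eta> d \<le> \<alpha> \<and>
        norm (fun_calc A (s_fun \<alpha>) (A (reg_solution A g x0 y \<alpha>) - y)) \<le> \<tau> * d \<alpha>}"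

definition RG_parameter ::
    "('a::real_inner \<Rightarrow> 'a) \<Rightarrow> (real \<Rightarrow> real \<Rightarrow> real) \<Rightarrow> 'a \<Rightarrow> 'a \<Rightarrow>
     real \<Rightarrow> real \<Rightarrow> real \<Rightarrow> real \<Rightarrow> (real \<Rightarrow> real) \<Rightarrow> real" where
  "RG_parameter A g x0 y q \<alpha>0 \<tau> \<eta> d =
     (if RG_admissible A g x0 y q \<alpha>0 \<tau> \<eta> d = {} then alpha_hat q \<alpha>0 \<eta> d
      else (GREATEST \<alpha>. \<alpha> \<in> RG_admissible A g x0 y q \<alpha>0 \<tau> \<eta> d))"

text \<open>Here \<open>\<delta>\<close> is the scalar noise level and \<open>\<zeta>\<close> the noise element.\<close>

definition noise_bound ::
    "('a::real_inner \<Rightarrow> 'a) \<Rightarrow> real \<Rightarrow> real \<Rightarrow> real \<Rightarrow> real \<Rightarrow> 'a \<Rightarrow> (real \<Rightarrow> real) \<Rightarrow> bool" where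
  "noise_bound A q \<alpha>0 \<eta> \<delta> \<zeta> d \<longleftrightarrow>
     (\<forall>\<alpha>>0. 0 < d \<alpha>) \<and>
     mono_on {0<..} d \<and>
     antimono_on {0<..} (\<lambda>\<alpha>. d \<alpha> / sqrt \<alpha>) \<and>
     (\<forall>\<alpha>\<in>grid q \<alpha>0. alpha_hat q \<alpha>0 \<eta> d \<le> \<alpha> \<longrightarrow>
        \<delta> * norm (fun_calc A (\<lambda>t. sqrt (s_fun \<alpha> t)) \<zeta>) \<le> d \<alpha>)"

end

theory Submission
  imports Defs
begin

text \<open>By the spectral theorem, all norms are weighted sums over the eigenvalues. The error splits into
  the bias \<open>r\<^sub>\<alpha>(A) w\<close>, \<open>w = xd - x0\<close>, which grows with \<open>\<alpha>\<close>, and the propagated noise, bounded by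
  a multiple of \<open>d \<alpha> / \<alpha>\<close>, which decreases. Up to an error \<open>d \<alpha>\<close> the discrepancy is
  \<open>\<parallel>s\<^sub>\<alpha>(A) A r\<^sub>\<alpha>(A) w\<parallel>\<close>. This is at most \<open>\<alpha>\<close> times the bias, so failure of the discrepancy principle
  at the grid point before \<open>\<alpha>\<^sub>*\<close> bounds the noise at \<open>\<alpha>\<^sub>*\<close> by the bias at larger parameters. By the
  source condition it is also at least a multiple of \<open>\<alpha>\<close> times the bias, so the discrepancy
  principle at \<open>\<alpha>\<^sub>*\<close> bounds the bias by \<open>d \<alpha>\<^sub>* / \<alpha>\<^sub>*\<close>, hence by \<open>d \<alpha> / \<alpha>\<close> at smaller parameters.\<close>

section \<open>Orthogonal projections and orthogonal series in Hilbert spaces\<close>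

lemma norm_diff_sq:
  fixes x y :: "'a::real_inner"
  shows "(norm (x - y))\<^sup>2 = (norm x)\<^sup>2 - 2 * (x \<bullet> y) + (norm y)\<^sup>2"
  by (simp add: power2_norm_eq_inner inner_diff_left inner_diff_right inner_commute)

lemma parallelogram_law:
  fixes x y :: "'a::real_inner"
  shows "(norm (x + y))\<^sup>2 + (norm (x - y))\<^sup>2 = 2 * (norm x)\<^sup>2 + 2 * (norm y)\<^sup>2"
  by (simp add: power2_norm_eq_inner algebra_simps)

text \<open>A minimizing sequence in \<open>S\<close> is Cauchy: midpoints of its members stay in
  \<open>S\<close>, hence at squared distance at least \<open>D\<close>, and the parallelogram law
  then forces the members together.\<close>

lemma exists_nearest_point:
  fixes S :: "'a::{real_inner,complete_space} set"
  assumes "subspace S" "closed S"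
  shows "\<exists>p\<in>S. \<forall>v\<in>S. (norm (w - p))\<^sup>2 \<le> (norm (w - v))\<^sup>2"
proof -
  define D where "D = (INF v\<in>S. (norm (w - v))\<^sup>2)"
  have ne: "S \<noteq> {}"
    using assms(1) subspace_0 by blast
  have bdd: "bdd_below ((\<lambda>v. (norm (w - v))\<^sup>2) ` S)"
    by (rule bdd_belowI2[where m = 0]) simp
  have D_le: "D \<le> (norm (w - v))\<^sup>2" if "v \<in> S" for v
    unfolding D_def by (rule cINF_lower[OF bdd that])
  have "\<exists>v\<in>S. (norm (w - v))\<^sup>2 < D + 1 / real (Suc n)" for n
  proof -
    have "D < D + 1 / real (Suc n)" by simp
    then show ?thesis
      unfolding D_def using cINF_less_iff[OF ne bdd] by blast
  qed
  then obtain v where v: "\<And>n. v n \<in> S" "\<And>n. (norm (w - v n))\<^sup>2 < D + 1 / real (Suc n)"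
    by metis
  have diff: "(norm (v m - v n))\<^sup>2 \<le> 2 / real (Suc m) + 2 / real (Suc n)" for m n
  proof -
    have "(1/2) *\<^sub>R (v m + v n) \<in> S"
      using assms(1) v(1) by (simp add: subspace_add subspace_scale)
    then have "D \<le> (norm (w - (1/2) *\<^sub>R (v m + v n)))\<^sup>2" by (rule D_le)
    moreover have "(w - v n) + (w - v m) = 2 *\<^sub>R (w - (1/2) *\<^sub>R (v m + v n))"
      by (simp add: algebra_simps scaleR_2)
    then have "(norm ((w - v n) + (w - v m)))\<^sup>2 = 4 * (norm (w - (1/2) *\<^sub>R (v m + v n)))\<^sup>2"
      by (simp add: power_mult_distrib)
    moreover have "(norm ((w - v n) + (w - v m)))\<^sup>2 + (norm (v m - v n))\<^sup>2
        = 2 * (norm (w - v n))\<^sup>2 + 2 * (norm (w - v m))\<^sup>2"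
      using parallelogram_law[of "w - v n" "w - v m"] by (simp add: algebra_simps)
    ultimately show ?thesis
      using v(2)[of m] v(2)[of n] by linarith
  qed
  have "Cauchy v"
  proof (rule CauchyI)
    fix e :: real assume "0 < e"
    then obtain M where M: "inverse (real (Suc M)) < e\<^sup>2 / 4"
      using reals_Archimedean[of "e\<^sup>2 / 4"] by auto
    have "norm (v m - v n) < e" if "m \<ge> M" "n \<ge> M" for m n
    proof -
      have "2 / real (Suc m) \<le> 2 * inverse (real (Suc M))" "2 / real (Suc n) \<le> 2 * inverse (real (Suc M))"
        using that by (auto simp: field_simps)
      with diff[of m n] M have "(norm (v m - v n))\<^sup>2 < e\<^sup>2" by linarith
      with \<open>0 < e\<close> show ?thesis by (simp add: power_less_imp_less_base)
    qed
    then show "\<exists>M. \<forall>m\<ge>M. \<forall>n\<ge>M. norm (v m - v n) < e" by blast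
  qed
  then obtain p where p: "v \<longlonglongrightarrow> p"
    using Cauchy_convergent convergent_def by blast
  have "p \<in> S"
    using closed_sequentially[OF assms(2) _ p] v(1) by blast
  moreover have "(norm (w - p))\<^sup>2 \<le> D"
  proof (rule LIMSEQ_le)
    show "(\<lambda>n. (norm (w - v n))\<^sup>2) \<longlonglongrightarrow> (norm (w - p))\<^sup>2"
      by (intro tendsto_intros p)
    show "(\<lambda>n. D + 1 / real (Suc n)) \<longlonglongrightarrow> D"
      using tendsto_add[OF tendsto_const LIMSEQ_inverse_real_of_nat, of D] by (simp add: inverse_eq_divide)
    show "\<exists>N. \<forall>n\<ge>N. (norm (w - v n))\<^sup>2 \<le> D + 1 / real (Suc n)"
      using v(2) less_imp_le by blast
  qed
  ultimately show ?thesis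
    using order.trans[OF _ D_le] by blast
qed

text \<open>The nearest point works: if \<open>w - p\<close> had a component along some
  \<open>v\<close> in \<open>S\<close>, moving \<open>p\<close> along \<open>v\<close> would bring
  it closer to \<open>w\<close>.\<close>

lemma exists_orth_proj:
  fixes S :: "'a::{real_inner,complete_space} set"
  assumes "subspace S" "closed S"
  shows "\<exists>p\<in>S. \<forall>v\<in>S. (w - p) \<bullet> v = 0"
proof -
  obtain p where p: "p \<in> S" "\<And>v. v \<in> S \<Longrightarrow> (norm (w - p))\<^sup>2 \<le> (norm (w - v))\<^sup>2"
    using exists_nearest_point[OF assms] by blast
  have "(w - p) \<bullet> v = 0" if "v \<in> S" for v
  proof (cases "v = 0")
    case False
    \<comment> \<open>This is the minimizer of \<open>norm (w - p - t *\<^sub>R v)\<close> over real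
      \<open>t\<close>.\<close>
    define t where "t = ((w - p) \<bullet> v) / (norm v)\<^sup>2"
    have "p + t *\<^sub>R v \<in> S"
      using assms(1) p(1) that by (simp add: subspace_add subspace_scale)
    then have "(norm (w - p))\<^sup>2 \<le> (norm ((w - p) - t *\<^sub>R v))\<^sup>2"
      using p(2) by (simp add: algebra_simps)
    also have "\<dots> = (norm (w - p))\<^sup>2 - ((w - p) \<bullet> v)\<^sup>2 / (norm v)\<^sup>2"
      unfolding norm_diff_sq using False
      by (simp add: t_def power_mult_distrib power2_eq_square field_simps)
    finally have "((w - p) \<bullet> v)\<^sup>2 / (norm v)\<^sup>2 \<le> 0" by simp
    then show ?thesis
      using False by (simp add: divide_le_0_iff)
  qed simp
  with p(1) show ?thesis by blast
qed

text \<open>Two candidates differ by a vector of \<open>S\<close> that is orthogonal to itself. This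
  characterization is how projections are computed below.\<close>

lemma orth_proj_eqI:
  assumes "subspace S" "p \<in> S" "\<And>v. v \<in> S \<Longrightarrow> (w - p) \<bullet> v = 0"
  shows "orth_proj S w = p"
  unfolding orth_proj_def
proof (rule the_equality)
  fix p' assume p': "p' \<in> S \<and> (\<forall>v\<in>S. (w - p') \<bullet> v = 0)"
  then have "p' - p \<in> S"
    using assms by (simp add: subspace_diff)
  then have "(w - p) \<bullet> (p' - p) = 0" "(w - p') \<bullet> (p' - p) = 0"
    using p' assms(3) by blast+
  then have "(p' - p) \<bullet> (p' - p) = 0"
    by (simp add: inner_diff_left)
  then show "p' = p" by simp
qed (use assms in blast)

lemma
  fixes S :: "'a::{real_inner,complete_space} set"
  assumes "subspace S" "closed S"
  shows orth_proj_in: "orth_proj S w \<in> S"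
    and orth_proj_orthogonal: "v \<in> S \<Longrightarrow> (w - orth_proj S w) \<bullet> v = 0"
proof -
  obtain p where p: "p \<in> S" "\<And>v. v \<in> S \<Longrightarrow> (w - p) \<bullet> v = 0"
    using exists_orth_proj[OF assms] by blast
  then have "orth_proj S w = p"
    using orth_proj_eqI assms(1) by blast
  with p show "orth_proj S w \<in> S" "v \<in> S \<Longrightarrow> (w - orth_proj S w) \<bullet> v = 0"
    by auto
qed

section \<open>Riesz representation and the adjoint\<close>

text \<open>Any nonzero vector \<open>z\<close> orthogonal to the kernel of \<open>\<phi>\<close>
  spans the complement of the kernel, so a multiple of \<open>z\<close> represents
  \<open>\<phi>\<close>.\<close>

lemma riesz_representation:
  fixes \<phi> :: "'a::{real_inner,complete_space} \<Rightarrow> real"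
  assumes "bounded_linear \<phi>"
  shows "\<exists>y. \<forall>x. \<phi> x = x \<bullet> y"
proof (cases "\<forall>x. \<phi> x = 0")
  case True
  then show ?thesis by (intro exI[of _ 0]) simp
next
  case False
  interpret bounded_linear \<phi> by fact
  define S where "S = {x. \<phi> x = 0}"
  have S: "subspace S" "closed S"
    unfolding S_def subspace_def by (auto simp: add scaleR zero intro!: closed_Collect_eq continuous_intros continuous_on)
  obtain x where x: "\<phi> x \<noteq> 0" using False by blast
  define z where "z = x - orth_proj S x"
  have z_orth: "z \<bullet> v = 0" if "\<phi> v = 0" for v
    unfolding z_def using orth_proj_orthogonal[OF S] that by (simp add: S_def)
  have "\<phi> (orth_proj S x) = 0"
    using orth_proj_in[OF S] unfolding S_def by blast
  then have \<phi>z: "\<phi> z = \<phi> x" by (simp add: z_def diff)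
  then have "z \<noteq> 0" using x zero by auto
  have "\<phi> v = v \<bullet> ((\<phi> z / (norm z)\<^sup>2) *\<^sub>R z)" for v
  proof -
    \<comment> \<open>Subtracting this multiple of \<open>z\<close> moves \<open>v\<close> into the
      kernel of \<open>\<phi>\<close>.\<close>
    have "z \<bullet> (v - (\<phi> v / \<phi> z) *\<^sub>R z) = 0"
      by (rule z_orth) (use x \<phi>z in \<open>simp add: diff scaleR\<close>)
    then have "v \<bullet> z = (\<phi> v / \<phi> z) * (norm z)\<^sup>2"
      by (simp add: inner_diff_right power2_norm_eq_inner inner_commute)
    then show ?thesis
      using x \<phi>z \<open>z \<noteq> 0\<close> by simp
  qed
  then show ?thesis by blast
qed

text \<open>\<open>adjoint\<close> is defined by choice, so its characteristic identity holds once
  some adjoint exists; Riesz supplies its value at each \<open>y\<close>.\<close>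

lemma adjoint_works_bounded_linear:
  fixes T :: "'a::{real_inner,complete_space} \<Rightarrow> 'b::real_inner"
  assumes "bounded_linear T"
  shows "x \<bullet> adjoint T y = T x \<bullet> y"
proof -
  have "\<exists>z. \<forall>x. T x \<bullet> y = x \<bullet> z" for y
    by (rule riesz_representation)
       (use bounded_linear_compose[OF bounded_linear_inner_left assms] in simp)
  then obtain f where f: "\<And>x y. T x \<bullet> y = x \<bullet> f y"
    by metis
  then show ?thesis
    using adjoint_unique[of T f] by simp
qed

section \<open>Orthogonal series\<close>

text \<open>By Pythagoras the finite partial sums of \<open>v\<close> inherit the Cauchy property
  from those of the squared norms; completeness of the space gives the limit.\<close>

lemma orthogonal_summable_on:
  fixes v :: "'i \<Rightarrow> 'a::{real_inner,complete_space}"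
  assumes orth: "\<And>i j. i \<in> I \<Longrightarrow> j \<in> I \<Longrightarrow> i \<noteq> j \<Longrightarrow> v i \<bullet> v j = 0"
    and summ: "(\<lambda>i. (norm (v i))\<^sup>2) summable_on I"
  shows "v summable_on I"
proof -
  have pyth: "(norm (sum v F))\<^sup>2 = (\<Sum>i\<in>F. (norm (v i))\<^sup>2)" if "finite F" "F \<subseteq> I" for F
    by (rule norm_sum_Pythagorean) (use that orth in \<open>auto simp: pairwise_def orthogonal_def\<close>)
  have "\<exists>P. eventually P (finite_subsets_at_top I) \<and>
          (\<forall>F F'. P F \<and> P F' \<longrightarrow> dist (sum v F) (sum v F') < e)" if "e > 0" for e
  proof -
    let ?N = "sum (\<lambda>i. (norm (v i))\<^sup>2)"
    obtain L where lim: "(?N \<longlongrightarrow> L) (finite_subsets_at_top I)"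
      using summ unfolding has_sum_def summable_on_def by blast
    then have "cauchy_filter (filtermap ?N (finite_subsets_at_top I))"
      by (auto intro!: nhds_imp_cauchy_filter simp: filterlim_def)
    moreover have "e\<^sup>2 / 4 > 0" using that by simp
    ultimately obtain P where P: "eventually P (finite_subsets_at_top I)"
        "\<And>F F'. P F \<Longrightarrow> P F' \<Longrightarrow> dist (?N F) (?N F') < e\<^sup>2 / 4"
      unfolding cauchy_filter_metric_filtermap by metis
    then obtain F0 where F0: "finite F0" "F0 \<subseteq> I"
        "\<And>F. finite F \<Longrightarrow> F0 \<subseteq> F \<Longrightarrow> F \<subseteq> I \<Longrightarrow> P F"
      unfolding eventually_finite_subsets_at_top by metis
    \<comment> \<open>Two large index sets are compared through \<open>F0\<close>: for nested sets
      the difference of the sums is a sum over \<open>F - F0\<close>, to which Pythagoras applies.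
      Each comparison costs \<open>e / 2\<close>.\<close>
    have close: "dist (sum v F) (sum v F0) < e / 2" if F: "finite F" "F0 \<subseteq> F" "F \<subseteq> I" for F
    proof -
      have "(norm (sum v F - sum v F0))\<^sup>2 = ?N (F - F0)"
        using F by (subst sum_diff[symmetric]) (auto intro!: pyth)
      also have "\<dots> = ?N F - ?N F0"
        using F by (subst sum_diff) auto
      also have "\<dots> < e\<^sup>2 / 4"
        using P(2)[OF F0(3)[OF F] F0(3)[OF F0(1) order.refl F0(2)]]
        unfolding dist_real_def by linarith
      also have "\<dots> = (e / 2)\<^sup>2" by (simp add: power2_eq_square)
      finally show ?thesis
        unfolding dist_norm by (rule power2_less_imp_less) (use \<open>e > 0\<close> in simp)
    qed
    have "dist (sum v F) (sum v F') < e"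
      if "finite F \<and> F0 \<subseteq> F \<and> F \<subseteq> I" "finite F' \<and> F0 \<subseteq> F' \<and> F' \<subseteq> I" for F F'
      using close[of F] close[of F'] dist_triangle2[of "sum v F" "sum v F'" "sum v F0"] that by auto
    moreover have "eventually (\<lambda>F. finite F \<and> F0 \<subseteq> F \<and> F \<subseteq> I) (finite_subsets_at_top I)"
      unfolding eventually_finite_subsets_at_top using F0(1,2) by blast
    ultimately show ?thesis
      by (intro exI[of _ "\<lambda>F. finite F \<and> F0 \<subseteq> F \<and> F \<subseteq> I"]) simp
  qed
  then have "cauchy_filter (filtermap (sum v) (finite_subsets_at_top I))"
    by (simp add: cauchy_filter_metric_filtermap)
  then have "convergent_filter (filtermap (sum v) (finite_subsets_at_top I))"
    by (rule cauchy_filter_convergent)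
  then show ?thesis
    unfolding convergent_filter_iff summable_on_def has_sum_def filterlim_def .
qed

lemma infsum_inner_left:
  fixes v :: "'i \<Rightarrow> 'a::real_inner"
  assumes "v summable_on I"
  shows "(\<lambda>i. v i \<bullet> u) summable_on I" "infsum v I \<bullet> u = (\<Sum>\<^sub>\<infinity>i\<in>I. v i \<bullet> u)"
proof -
  have "((\<lambda>i. v i \<bullet> u) has_sum infsum v I \<bullet> u) I"
    using has_sum_bounded_linear[OF bounded_linear_inner_left has_sum_infsum[OF assms]] .
  then show "(\<lambda>i. v i \<bullet> u) summable_on I" "infsum v I \<bullet> u = (\<Sum>\<^sub>\<infinity>i\<in>I. v i \<bullet> u)"
    by (auto simp: has_sum_iff)
qed

lemma infsum_inner_orthogonal:
  fixes v :: "'i \<Rightarrow> 'a::real_inner"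
  assumes "v summable_on I" "j \<in> I" "\<And>i. i \<in> I \<Longrightarrow> i \<noteq> j \<Longrightarrow> v i \<bullet> u = 0"
  shows "infsum v I \<bullet> u = v j \<bullet> u"
proof -
  have "infsum v I \<bullet> u = (\<Sum>\<^sub>\<infinity>i\<in>{j}. v i \<bullet> u)"
    unfolding infsum_inner_left(2)[OF assms(1)]
    by (rule infsum_cong_neutral) (use assms in auto)
  then show ?thesis by simp
qed

lemma norm_infsum_orthogonal:
  fixes v :: "'i \<Rightarrow> 'a::real_inner"
  assumes "v summable_on I" "\<And>i j. i \<in> I \<Longrightarrow> j \<in> I \<Longrightarrow> i \<noteq> j \<Longrightarrow> v i \<bullet> v j = 0"
  shows "(norm (infsum v I))\<^sup>2 = (\<Sum>\<^sub>\<infinity>i\<in>I. (norm (v i))\<^sup>2)"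
proof -
  have "(norm (infsum v I))\<^sup>2 = (\<Sum>\<^sub>\<infinity>i\<in>I. v i \<bullet> infsum v I)"
    using infsum_inner_left(2)[OF assms(1)] by (simp add: power2_norm_eq_inner)
  also have "\<dots> = (\<Sum>\<^sub>\<infinity>i\<in>I. (norm (v i))\<^sup>2)"
  proof (rule infsum_cong)
    fix i assume "i \<in> I"
    then have "infsum v I \<bullet> v i = v i \<bullet> v i"
      by (intro infsum_inner_orthogonal) (use assms in auto)
    then show "v i \<bullet> infsum v I = (norm (v i))\<^sup>2"
      by (simp add: inner_commute power2_norm_eq_inner)
  qed
  finally show ?thesis .
qed

section \<open>Spectral theorem for \<open>T\<^sup>* T\<close>\<close>

text \<open>The adjoint enters only through the identity \<open>gram\<close>, from which linearity,
  boundedness, symmetry and non-negativity of \<open>A\<close> follow.\<close>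

locale compact_gram_operator =
  fixes T :: "'a::{real_inner,complete_space} \<Rightarrow> 'b::real_inner" and A :: "'a \<Rightarrow> 'a"
  assumes compact_T: "compact_operator T"
    and gram: "A x \<bullet> y = T x \<bullet> T y"
begin

lemma bounded_linear_T: "bounded_linear T"
  using compact_T unfolding compact_operator_def by blast

text \<open>Besides boundedness, this transfers convergence from \<open>T (x n)\<close> to
  \<open>A (x n)\<close>, so the compactness of \<open>T\<close> can be used directly. It follows
  from Cauchy-Schwarz applied to \<open>T x \<bullet> T (A x)\<close>.\<close>

lemma norm_A_le_T: "\<exists>K>0. \<forall>x. norm (A x) \<le> K * norm (T x)"
proof -
  obtain K where K: "K > 0" "\<And>x. norm (T x) \<le> norm x * K"
    using bounded_linear.pos_bounded[OF bounded_linear_T] by blast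
  have "norm (A x) \<le> K * norm (T x)" for x
  proof (cases "A x = 0")
    case False
    have "norm (A x) * norm (A x) = T x \<bullet> T (A x)"
      by (simp add: gram[symmetric] power2_norm_eq_inner[symmetric] power2_eq_square)
    also have "\<dots> \<le> norm (T x) * norm (T (A x))"
      by (rule norm_cauchy_schwarz)
    also have "\<dots> \<le> norm (T x) * (norm (A x) * K)"
      by (rule mult_left_mono[OF K(2)]) simp
    finally have "norm (A x) * norm (A x) \<le> norm (A x) * (K * norm (T x))"
      by (simp add: ac_simps)
    then show ?thesis using False by simp
  qed (use K(1) in simp)
  with K(1) show ?thesis by blast
qed

lemma bounded_linear_A: "bounded_linear A"
proof -
  interpret T: bounded_linear T by (rule bounded_linear_T)
  obtain K1 where K1: "K1 > 0" "\<And>x. norm (A x) \<le> K1 * norm (T x)"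
    using norm_A_le_T by blast
  obtain K2 where K2: "\<And>x. norm (T x) \<le> norm x * K2"
    using T.bounded by blast
  show ?thesis
  proof (rule bounded_linear_intro)
    have "\<forall>z. A (x + y) \<bullet> z = (A x + A y) \<bullet> z" for x y
      by (simp add: gram inner_add_left T.add)
    then show "A (x + y) = A x + A y" for x y
      by (simp only: vector_eq_rdot)
    have "\<forall>z. A (r *\<^sub>R x) \<bullet> z = (r *\<^sub>R A x) \<bullet> z" for r x
      by (simp add: gram T.scaleR)
    then show "A (r *\<^sub>R x) = r *\<^sub>R A x" for r x
      by (simp only: vector_eq_rdot)
    show "norm (A x) \<le> norm x * (K1 * K2)" for x
      using order.trans[OF K1(2) mult_left_mono[OF K2], of x] K1(1) by (simp add: ac_simps)
  qed
qed

sublocale A: bounded_linear A by (rule bounded_linear_A)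
sublocale T: bounded_linear T by (rule bounded_linear_T)

lemma A_symmetric: "A x \<bullet> y = x \<bullet> A y"
  using gram[of x y] gram[of y x] by (simp add: inner_commute)

text \<open>This places the eigenvalues in the interval on which the assumptions on \<open>g\<close>
  hold.\<close>

lemma eigenvalue_bounds:
  assumes "l \<in> eigenvalues A"
  shows "l \<in> {0..onorm A}"
proof -
  obtain v where v: "v \<noteq> 0" "A v = l *\<^sub>R v"
    using assms unfolding eigenvalues_def by blast
  have "l * (norm v)\<^sup>2 = (norm (T v))\<^sup>2"
    using gram[of v v] v(2) by (simp add: power2_norm_eq_inner)
  then have "0 \<le> l * (norm v)\<^sup>2" by simp
  then have "0 \<le> l"
    using v(1) by (simp add: zero_le_mult_iff)
  moreover have "\<bar>l\<bar> * norm v \<le> onorm A * norm v"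
    using onorm[OF bounded_linear_A, of v] v(2) by simp
  then have "\<bar>l\<bar> \<le> onorm A"
    using v(1) by simp
  ultimately show ?thesis by simp
qed

text \<open>The eigenvector is the limit of a sequence of unit vectors in \<open>M\<close> that maximizes
  \<open>norm (T x)\<close>; such vectors satisfy \<open>A x - s\<^sup>2 x \<rightarrow> 0\<close>, where \<open>s\<close> is the supremum.\<close>

lemma exists_eigenvector:
  assumes M: "subspace M" "closed M" "\<And>x. x \<in> M \<Longrightarrow> A x \<in> M"
    and nz: "u \<in> M" "T u \<noteq> 0"
  shows "\<exists>v\<in>M. \<exists>l. v \<noteq> 0 \<and> A v = l *\<^sub>R v"
proof -
  define U where "U = {x \<in> M. norm x = 1}"
  define s where "s = (SUP x\<in>U. norm (T x))"
  have normalize: "(1 / norm x) *\<^sub>R x \<in> U" if "x \<in> M" "x \<noteq> 0" for x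
    using that M(1) by (simp add: U_def subspace_scale)
  have "u \<noteq> 0" using nz T.zero by auto
  then have U_ne: "U \<noteq> {}" using normalize nz by blast
  obtain K where K: "\<And>x. norm (T x) \<le> norm x * K"
    using T.bounded by blast
  have bdd: "bdd_above ((\<lambda>x. norm (T x)) ` U)"
  proof (rule bdd_aboveI2)
    show "norm (T x) \<le> K" if "x \<in> U" for x
      using K[of x] that by (simp add: U_def)
  qed
  have s_upper: "norm (T x) \<le> s" if "x \<in> U" for x
    unfolding s_def by (rule cSUP_upper[OF that bdd])
  have T_le: "norm (T x) \<le> s * norm x" if "x \<in> M" for x
  proof (cases "x = 0")
    case False
    then show ?thesis
      using s_upper[OF normalize[OF that False]] by (simp add: T.scaleR field_simps)
  qed simp
  have "s > 0"
  proof -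
    have "0 < norm (T u)" using nz by simp
    also have "\<dots> \<le> s * norm u" by (rule T_le[OF nz(1)])
    finally show ?thesis by (simp add: zero_less_mult_iff)
  qed
  have "\<exists>x\<in>U. s - 1 / real (Suc n) < norm (T x)" for n
  proof -
    have "s - 1 / real (Suc n) < s" by simp
    then show ?thesis
      unfolding s_def using less_cSUP_iff[OF U_ne bdd] by blast
  qed
  then obtain x where x: "\<And>n. x n \<in> U" "\<And>n. s - 1 / real (Suc n) < norm (T (x n))"
    by metis
  then have xM: "x n \<in> M" and xn: "norm (x n) = 1" for n
    by (auto simp: U_def)
  have lim_Tx: "(\<lambda>n. norm (T (x n))) \<longlonglongrightarrow> s"
  proof (rule tendsto_sandwich)
    show "(\<lambda>n. s - 1 / real (Suc n)) \<longlonglongrightarrow> s"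
      using tendsto_diff[OF tendsto_const LIMSEQ_inverse_real_of_nat, of s] by (simp add: inverse_eq_divide)
    show "\<forall>\<^sub>F n in sequentially. s - 1 / real (Suc n) \<le> norm (T (x n))"
      using x(2) by (intro always_eventually allI less_imp_le)
    show "\<forall>\<^sub>F n in sequentially. norm (T (x n)) \<le> s"
      using s_upper[OF x(1)] by (intro always_eventually allI)
  qed simp
  \<comment> \<open>Expanding the square uses \<open>A x \<bullet> x = (norm (T x))\<^sup>2\<close>
    and \<open>norm (A x) \<le> s * norm (T x)\<close>; the latter relies on \<open>A x\<close>
    lying in \<open>M\<close>, where \<open>s\<close> bounds \<open>T\<close>.\<close>
  have defect: "(norm (A (x n) - s\<^sup>2 *\<^sub>R x n))\<^sup>2 \<le> s\<^sup>2 * (s\<^sup>2 - (norm (T (x n)))\<^sup>2)" for n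
  proof -
    have "norm (A (x n)) * norm (A (x n)) = T (x n) \<bullet> T (A (x n))"
      by (simp add: gram[symmetric] power2_norm_eq_inner[symmetric] power2_eq_square)
    also have "\<dots> \<le> norm (T (x n)) * (s * norm (A (x n)))"
      by (rule order.trans[OF norm_cauchy_schwarz]) (intro mult_left_mono T_le M(3) xM, simp)
    finally have "norm (A (x n)) * norm (A (x n)) \<le> norm (A (x n)) * (s * norm (T (x n)))"
      by (simp add: ac_simps)
    then have "norm (A (x n)) \<le> s * norm (T (x n))"
      using \<open>s > 0\<close> by (cases "A (x n) = 0") auto
    then have "(norm (A (x n)))\<^sup>2 \<le> (s * norm (T (x n)))\<^sup>2"
      by (rule power_mono) simp
    moreover have "(norm (A (x n) - s\<^sup>2 *\<^sub>R x n))\<^sup>2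
        = (norm (A (x n)))\<^sup>2 - 2 * s\<^sup>2 * (norm (T (x n)))\<^sup>2 + s\<^sup>2 * s\<^sup>2"
      unfolding norm_diff_sq by (simp add: gram xn power2_norm_eq_inner[symmetric] power2_eq_square)
    ultimately show ?thesis
      by (simp add: power_mult_distrib right_diff_distrib)
  qed
  have lim_defect: "(\<lambda>n. A (x n) - s\<^sup>2 *\<^sub>R x n) \<longlonglongrightarrow> 0"
  proof -
    have "(\<lambda>n. s\<^sup>2 * (s\<^sup>2 - (norm (T (x n)))\<^sup>2)) \<longlonglongrightarrow> s\<^sup>2 * (s\<^sup>2 - s\<^sup>2)"
      by (intro tendsto_intros lim_Tx)
    then have "(\<lambda>n. s\<^sup>2 * (s\<^sup>2 - (norm (T (x n)))\<^sup>2)) \<longlonglongrightarrow> 0" by simp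
    then have "(\<lambda>n. (norm (A (x n) - s\<^sup>2 *\<^sub>R x n))\<^sup>2) \<longlonglongrightarrow> 0"
      by (rule tendsto_sandwich[OF _ _ tendsto_const, rotated -1]) (use defect in auto)
    then have "(\<lambda>n. sqrt ((norm (A (x n) - s\<^sup>2 *\<^sub>R x n))\<^sup>2)) \<longlonglongrightarrow> sqrt 0"
      by (rule tendsto_real_sqrt)
    then show ?thesis
      by (simp add: tendsto_norm_zero_iff)
  qed
  have "compact (closure (T ` cball 0 1))"
    using compact_T unfolding compact_operator_def by blast
  moreover have "T (x n) \<in> closure (T ` cball 0 1)" for n
    using xn[of n] closure_subset by fastforce
  ultimately obtain y r where r: "strict_mono r" and y: "(T \<circ> (x \<circ> r)) \<longlonglongrightarrow> y"
    unfolding compact_def by (metis comp_assoc comp_apply)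
  obtain L where L: "L > 0" "\<And>x. norm (A x) \<le> L * norm (T x)"
    using norm_A_le_T by blast
  have "Cauchy (\<lambda>n. A (x (r n)))"
  proof (rule CauchyI)
    fix e :: real assume "0 < e"
    then have "0 < e / L" using L(1) by simp
    moreover have "Cauchy (\<lambda>n. T (x (r n)))"
      using LIMSEQ_imp_Cauchy[OF y] by (simp add: o_def)
    ultimately obtain N where N: "\<And>m n. m \<ge> N \<Longrightarrow> n \<ge> N \<Longrightarrow> norm (T (x (r m)) - T (x (r n))) < e / L"
      using CauchyD by metis
    have "norm (A (x (r m)) - A (x (r n))) < e" if "m \<ge> N" "n \<ge> N" for m n
    proof -
      have "norm (A (x (r m)) - A (x (r n))) \<le> L * norm (T (x (r m)) - T (x (r n)))"
        using L(2)[of "x (r m) - x (r n)"] by (simp add: A.diff T.diff)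
      also have "\<dots> < L * (e / L)"
        using N[OF that] L(1) by (rule mult_strict_left_mono)
      finally show ?thesis using L(1) by simp
    qed
    then show "\<exists>N. \<forall>m\<ge>N. \<forall>n\<ge>N. norm (A (x (r m)) - A (x (r n))) < e" by blast
  qed
  then obtain z where z: "(\<lambda>n. A (x (r n))) \<longlonglongrightarrow> z"
    using Cauchy_convergent convergent_def by blast
  define v where "v = (1 / s\<^sup>2) *\<^sub>R z"
  \<comment> \<open>Up to the vanishing defect, \<open>x (r n)\<close> equals
    \<open>A (x (r n))\<close> divided by \<open>s\<^sup>2\<close>; hence the unit vectors
    themselves converge, and their limit is nonzero.\<close>
  have "(\<lambda>n. (1 / s\<^sup>2) *\<^sub>R (A (x (r n)) - (A (x (r n)) - s\<^sup>2 *\<^sub>R x (r n)))) \<longlonglongrightarrow> (1 / s\<^sup>2) *\<^sub>R (z - 0)"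
    using LIMSEQ_subseq_LIMSEQ[OF lim_defect r] z by (intro tendsto_intros) (auto simp: o_def)
  then have lim_x: "(\<lambda>n. x (r n)) \<longlonglongrightarrow> v"
    using \<open>s > 0\<close> by (simp add: v_def)
  have "v \<in> M"
    using closed_sequentially[OF M(2) _ lim_x] xM by blast
  moreover have "norm v = 1"
    using LIMSEQ_unique[OF tendsto_norm[OF lim_x]] xn by simp
  then have "v \<noteq> 0" by auto
  moreover have "A v = z"
    using LIMSEQ_unique[OF A.tendsto[OF lim_x] z] .
  then have "A v = s\<^sup>2 *\<^sub>R v"
    using \<open>s > 0\<close> by (simp add: v_def)
  ultimately show ?thesis by blast
qed

section \<open>Eigenspace projections and Bessel's inequality\<close>

abbreviation eproj :: "real \<Rightarrow> 'a \<Rightarrow> 'a" where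
  "eproj l w \<equiv> orth_proj (eigenspace A l) w"

lemma subspace_eigenspace: "subspace (eigenspace A l)"
  unfolding subspace_def eigenspace_def by (simp add: A.add A.scaleR A.zero algebra_simps)

lemma closed_eigenspace: "closed (eigenspace A l)"
  unfolding eigenspace_def by (intro closed_Collect_eq A.continuous_on continuous_intros)

lemmas eproj_eqI = orth_proj_eqI[OF subspace_eigenspace]
lemmas eproj_in = orth_proj_in[OF subspace_eigenspace closed_eigenspace]
lemmas eproj_orthogonal = orth_proj_orthogonal[OF subspace_eigenspace closed_eigenspace]

lemma eigenspaces_orthogonal:
  assumes "u \<in> eigenspace A l" "v \<in> eigenspace A m" "l \<noteq> m"
  shows "u \<bullet> v = 0"
  using A_symmetric[of u v] assms by (simp add: eigenspace_def)

lemma inner_eproj: "v \<in> eigenspace A l \<Longrightarrow> eproj l w \<bullet> v = w \<bullet> v"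
  using eproj_orthogonal[of v l w] by (simp add: inner_diff_left)

lemma eprojs_orthogonal: "l \<noteq> m \<Longrightarrow> eproj l u \<bullet> eproj m w = 0"
  by (rule eigenspaces_orthogonal[OF eproj_in eproj_in])

lemma eproj_add: "eproj l (u + w) = eproj l u + eproj l w"
  by (rule eproj_eqI) (auto simp: subspace_add subspace_eigenspace eproj_in inner_eproj
    inner_add_left inner_diff_left)

lemma eproj_scaleR: "eproj l (c *\<^sub>R w) = c *\<^sub>R eproj l w"
  by (rule eproj_eqI) (auto simp: subspace_scale subspace_eigenspace eproj_in inner_eproj
    inner_diff_left)

lemma eproj_minus: "eproj l (- w) = - eproj l w"
  using eproj_scaleR[of l "-1" w] by simp

lemma eproj_diff: "eproj l (u - w) = eproj l u - eproj l w"
  using eproj_add[of l u "- w"] by (simp add: eproj_minus)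

text \<open>Symmetry moves \<open>A\<close> onto the eigenvector. In eigencomponents,
  \<open>A\<close> thus acts as multiplication by \<open>l\<close>.\<close>

lemma eproj_A: "eproj l (A w) = l *\<^sub>R eproj l w"
proof (rule eproj_eqI)
  fix v assume v: "v \<in> eigenspace A l"
  then have "A v = l *\<^sub>R v" by (simp add: eigenspace_def)
  with inner_eproj[OF v, of w] show "(A w - l *\<^sub>R eproj l w) \<bullet> v = 0"
    by (simp add: inner_diff_left A_symmetric)
qed (simp add: subspace_scale subspace_eigenspace eproj_in)

text \<open>The finite sum \<open>y\<close> of projections satisfies
  \<open>w \<bullet> y = (norm y)\<^sup>2\<close>, so the claim is the non-negativity of
  \<open>(norm (w - y))\<^sup>2\<close>.\<close>

lemma bessel:
  assumes "finite F"
  shows "(\<Sum>l\<in>F. (norm (eproj l w))\<^sup>2) \<le> (norm w)\<^sup>2"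
proof -
  define y where "y = (\<Sum>l\<in>F. eproj l w)"
  have ny: "(norm y)\<^sup>2 = (\<Sum>l\<in>F. (norm (eproj l w))\<^sup>2)"
    unfolding y_def
    by (rule norm_sum_Pythagorean[OF assms])
       (simp add: pairwise_def orthogonal_def eprojs_orthogonal)
  have "w \<bullet> y = (\<Sum>l\<in>F. (norm (eproj l w))\<^sup>2)"
    unfolding y_def inner_sum_right
    by (intro sum.cong refl) (simp add: inner_eproj[OF eproj_in] power2_norm_eq_inner)
  then have "(norm (w - y))\<^sup>2 = (norm w)\<^sup>2 - (\<Sum>l\<in>F. (norm (eproj l w))\<^sup>2)"
    unfolding norm_diff_sq using ny by simp
  then show ?thesis
    using zero_le_power2[of "norm (w - y)"] by linarith
qed

lemma norm_eproj_summable: "(\<lambda>l. (norm (eproj l w))\<^sup>2) summable_on L"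
  by (rule nonneg_bdd_above_summable_on) (auto intro!: bdd_aboveI2[where M = "(norm w)\<^sup>2"] bessel)

lemma weighted_summable:
  assumes "bounded (f ` L)"
  shows "(\<lambda>l. (f l)\<^sup>2 * (norm (eproj l w))\<^sup>2) summable_on L"
proof -
  obtain B where B: "\<And>l. l \<in> L \<Longrightarrow> norm (f l) \<le> B"
    using assms unfolding bounded_iff by auto
  have "(\<lambda>l. B\<^sup>2 * (norm (eproj l w))\<^sup>2) summable_on L"
    by (intro summable_on_cmult_right norm_eproj_summable)
  moreover have "(f l)\<^sup>2 * (norm (eproj l w))\<^sup>2 \<le> B\<^sup>2 * (norm (eproj l w))\<^sup>2" if "l \<in> L" for l
    using B[OF that] by (intro mult_right_mono) (auto simp: abs_le_square_iff[symmetric])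
  ultimately show ?thesis
    by (rule summable_on_comparison_test) auto
qed

section \<open>Functional calculus for functions bounded on the eigenvalues\<close>

context
  fixes f :: "real \<Rightarrow> real"
  assumes bounded_f: "bounded (f ` eigenvalues A)"
begin

lemma fun_calc_summable: "(\<lambda>l. f l *\<^sub>R eproj l w) summable_on eigenvalues A"
proof (rule orthogonal_summable_on)
  show "(\<lambda>l. (norm (f l *\<^sub>R eproj l w))\<^sup>2) summable_on eigenvalues A"
    using weighted_summable[OF bounded_f] by (simp add: power_mult_distrib)
qed (simp add: eprojs_orthogonal)

lemma norm_fun_calc:
  "(norm (fun_calc A f w))\<^sup>2 = (\<Sum>\<^sub>\<infinity>l\<in>eigenvalues A. (f l)\<^sup>2 * (norm (eproj l w))\<^sup>2)"
  unfolding fun_calc_def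
  by (subst norm_infsum_orthogonal[OF fun_calc_summable])
     (simp_all add: eprojs_orthogonal power_mult_distrib)

lemma eproj_fun_calc:
  assumes "l \<in> eigenvalues A"
  shows "eproj l (fun_calc A f w) = f l *\<^sub>R eproj l w"
proof (rule eproj_eqI)
  show "f l *\<^sub>R eproj l w \<in> eigenspace A l"
    by (simp add: subspace_scale subspace_eigenspace eproj_in)
  fix v assume v: "v \<in> eigenspace A l"
  have "fun_calc A f w \<bullet> v = f l *\<^sub>R eproj l w \<bullet> v"
    unfolding fun_calc_def
    by (rule infsum_inner_orthogonal[OF fun_calc_summable assms])
       (use eigenspaces_orthogonal[OF eproj_in v] in simp)
  then show "(fun_calc A f w - f l *\<^sub>R eproj l w) \<bullet> v = 0"
    by (simp add: inner_diff_left)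
qed

end

section \<open>Completeness of the eigenspaces and its consequences\<close>

text \<open>The orthogonal complement \<open>M\<close> of all eigenspaces is closed and invariant
  under \<open>A\<close> and contains no eigenvector. A nonzero \<open>u\<close> in \<open>M\<close>
  contradicts this: either \<open>T u\<close> is nonzero and \<open>exists_eigenvector\<close>
  applies, or \<open>u\<close> itself is an eigenvector for the eigenvalue 0.\<close>

lemma eproj_complete:
  assumes "\<And>l. l \<in> eigenvalues A \<Longrightarrow> eproj l u = 0"
  shows "u = 0"
proof (rule ccontr)
  assume "u \<noteq> 0"
  define M where "M = {x. \<forall>l\<in>eigenvalues A. \<forall>v\<in>eigenspace A l. x \<bullet> v = 0}"
  have "u \<in> M"
  proof -
    have "u \<bullet> v = 0" if "l \<in> eigenvalues A" "v \<in> eigenspace A l" for l v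
      using inner_eproj[OF that(2), of u] assms[OF that(1)] by simp
    then show ?thesis by (simp add: M_def)
  qed
  have no_eigenvector: "v = 0" if "v \<in> M" "A v = l *\<^sub>R v" for v l
  proof (rule ccontr)
    assume "v \<noteq> 0"
    then have "l \<in> eigenvalues A" "v \<in> eigenspace A l"
      using that by (auto simp: eigenvalues_def eigenspace_def)
    then have "v \<bullet> v = 0"
      using that(1) unfolding M_def by blast
    with \<open>v \<noteq> 0\<close> show False by simp
  qed
  have "subspace M"
    unfolding subspace_def M_def by (simp add: inner_add_left)
  moreover have "closed M"
    unfolding M_def Ball_def
    by (intro closed_Collect_all closed_Collect_imp open_Collect_const closed_Collect_eq continuous_intros)
  moreover have "A x \<in> M" if "x \<in> M" for x
    unfolding M_def
  proof (intro CollectI ballI)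
    fix l v assume "l \<in> eigenvalues A" and v: "v \<in> eigenspace A l"
    then have "x \<bullet> v = 0" using that by (auto simp: M_def)
    moreover have "A v = l *\<^sub>R v" using v by (simp add: eigenspace_def)
    ultimately show "A x \<bullet> v = 0"
      by (simp add: A_symmetric)
  qed
  moreover have "T u \<noteq> 0"
  proof
    assume "T u = 0"
    then have "\<forall>y. A u \<bullet> y = 0 \<bullet> y" by (simp add: gram)
    then have "A u = 0 *\<^sub>R u" by (simp only: vector_eq_rdot scaleR_zero_left)
    with no_eigenvector[OF \<open>u \<in> M\<close>] \<open>u \<noteq> 0\<close> show False by blast
  qed
  ultimately obtain v l where "v \<in> M" "v \<noteq> 0" "A v = l *\<^sub>R v"
    using exists_eigenvector[of M u] \<open>u \<in> M\<close> by blast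
  with no_eigenvector show False by blast
qed

text \<open>This reduces identities between vectors built from \<open>A\<close> and
  \<open>fun_calc\<close> to scalar identities at each eigenvalue.\<close>

lemma eproj_eq_imp_eq:
  assumes "\<And>l. l \<in> eigenvalues A \<Longrightarrow> eproj l u = eproj l w"
  shows "u = w"
  using eproj_complete[of "u - w"] assms by (simp add: eproj_diff)

lemma norm_fun_calc_mono:
  assumes "\<And>l. l \<in> eigenvalues A \<Longrightarrow> \<bar>f l\<bar> \<le> \<bar>h l\<bar>" "bounded (h ` eigenvalues A)"
  shows "norm (fun_calc A f w) \<le> norm (fun_calc A h w)"
proof -
  have "bounded (f ` eigenvalues A)"
    using assms unfolding bounded_iff by (metis (no_types, lifting) image_iff order.trans real_norm_def)
  moreover have "(f l)\<^sup>2 * (norm (eproj l w))\<^sup>2 \<le> (h l)\<^sup>2 * (norm (eproj l w))\<^sup>2"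
    if "l \<in> eigenvalues A" for l
    using assms(1)[OF that] by (intro mult_right_mono) (auto simp: abs_le_square_iff[symmetric])
  ultimately have "(norm (fun_calc A f w))\<^sup>2 \<le> (norm (fun_calc A h w))\<^sup>2"
    using assms(2) by (auto simp: norm_fun_calc intro!: infsum_mono weighted_summable)
  then show ?thesis by (rule power2_le_imp_le) simp
qed

lemma fun_calc_scale:
  assumes "bounded (f ` eigenvalues A)"
  shows "fun_calc A (\<lambda>l. c * f l) w = c *\<^sub>R fun_calc A f w"
proof (rule eproj_eq_imp_eq)
  have "bounded ((\<lambda>l. c * f l) ` eigenvalues A)"
    using bounded_scaleR_comp[OF assms, of c] by simp
  then show "eproj l (fun_calc A (\<lambda>l. c * f l) w) = eproj l (c *\<^sub>R fun_calc A f w)"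
    if "l \<in> eigenvalues A" for l
    using that assms by (simp add: eproj_scaleR eproj_fun_calc)
qed

lemma fun_calc_const_1: "fun_calc A (\<lambda>_. 1) w = w"
  by (rule eproj_eq_imp_eq) (simp add: eproj_fun_calc image_constant_conv)

text \<open>Used to split the bias into a low and a high frequency part.\<close>

lemma fun_calc_sum_squares_le:
  assumes "\<And>l. l \<in> eigenvalues A \<Longrightarrow> (f l)\<^sup>2 \<le> (h l)\<^sup>2 + (k l)\<^sup>2"
    and bd: "bounded (f ` eigenvalues A)" "bounded (h ` eigenvalues A)" "bounded (k ` eigenvalues A)"
  shows "(norm (fun_calc A f w))\<^sup>2 \<le> (norm (fun_calc A h w))\<^sup>2 + (norm (fun_calc A k w))\<^sup>2"
proof -
  have "(f l)\<^sup>2 * (norm (eproj l w))\<^sup>2 \<le> (h l)\<^sup>2 * (norm (eproj l w))\<^sup>2 + (k l)\<^sup>2 * (norm (eproj l w))\<^sup>2"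
    if "l \<in> eigenvalues A" for l
    using mult_right_mono[OF assms(1)[OF that], of "(norm (eproj l w))\<^sup>2"] by (simp add: distrib_right)
  then show ?thesis
    unfolding norm_fun_calc[OF bd(1)] norm_fun_calc[OF bd(2)] norm_fun_calc[OF bd(3)]
      infsum_add[OF weighted_summable[OF bd(2)] weighted_summable[OF bd(3)], symmetric]
    by (intro infsum_mono weighted_summable bd summable_on_add) auto
qed

section \<open>The spectral measure and its integrals\<close>

lemma weighted_abs_summable:
  assumes "bounded (f ` eigenvalues A)"
  shows "Infinite_Set_Sum.abs_summable_on (\<lambda>l. (f l)\<^sup>2 * (norm (eproj l w))\<^sup>2) (eigenvalues A)"
  using weighted_summable[OF assms, of w] by (simp add: abs_summable_equivalent[symmetric] abs_mult)

lemma norm_fun_calc_infsetsum: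
  assumes "bounded (f ` eigenvalues A)"
  shows "(norm (fun_calc A f w))\<^sup>2 = infsetsum (\<lambda>l. (f l)\<^sup>2 * (norm (eproj l w))\<^sup>2) (eigenvalues A)"
  by (simp add: norm_fun_calc[OF assms] infsetsum_infsum weighted_abs_summable[OF assms])

lemma bounded_indicator_image: "bounded (indicat_real B ` L)"
  unfolding bounded_iff by (rule exI[of _ 1]) (auto simp: indicator_def)

text \<open>The density measure assigns to every set the value used in
  \<open>spectral_measure\<close>, so that set function is a measure and \<open>measure_of\<close>
  returns the density measure itself.\<close>

lemma spectral_measure_eq_density:
  "spectral_measure A w =
     density (count_space UNIV) (\<lambda>l. ennreal (indicat_real (eigenvalues A) l * (norm (eproj l w))\<^sup>2))"
    (is "_ = ?M")
proof -
  have "emeasure ?M B = ennreal ((norm (spectral_projection A B w))\<^sup>2)" for B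
  proof -
    have "emeasure ?M B = (\<integral>\<^sup>+ l. ennreal ((indicat_real B l)\<^sup>2 * (norm (eproj l w))\<^sup>2) *
        indicator (eigenvalues A) l \<partial>count_space UNIV)"
      by (subst emeasure_density) (auto intro!: nn_integral_cong simp: indicator_def)
    also have "\<dots> = (\<integral>\<^sup>+ l. ennreal ((indicat_real B l)\<^sup>2 * (norm (eproj l w))\<^sup>2) \<partial>count_space (eigenvalues A))"
      by (rule nn_integral_count_space_indicator[symmetric]) simp
    also have "\<dots> = ennreal ((norm (spectral_projection A B w))\<^sup>2)"
      unfolding spectral_projection_def norm_fun_calc_infsetsum[OF bounded_indicator_image]
      by (rule nn_integral_conv_infsetsum[OF weighted_abs_summable[OF bounded_indicator_image]]) simp
    finally show ?thesis .
  qed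
  then have "emeasure ?M = (\<lambda>B. ennreal ((norm (spectral_projection A B w))\<^sup>2))"
    by (rule ext)
  then show ?thesis
    using measure_of_of_measure[of ?M] by (simp add: spectral_measure_def)
qed

text \<open>Turns both integrals of the source condition into norms; the square in the integrand
  covers the constant 1 as well as the squared residual.\<close>

lemma set_integral_spectral_measure:
  assumes "bounded ((\<lambda>l. indicat_real S l * f l) ` eigenvalues A)"
  shows "(LINT t:S|spectral_measure A w. (f t)\<^sup>2) = (norm (fun_calc A (\<lambda>l. indicator S l * f l) w))\<^sup>2"
proof -
  have "(LINT t:S|spectral_measure A w. (f t)\<^sup>2) =
      (LINT l|count_space UNIV. (indicat_real (eigenvalues A) l * (norm (eproj l w))\<^sup>2) *\<^sub>R
         (indicat_real S l *\<^sub>R (f l)\<^sup>2))"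
    unfolding set_lebesgue_integral_def spectral_measure_eq_density
    by (rule integral_density) auto
  also have "\<dots> = infsetsum (\<lambda>l. (indicat_real S l * f l)\<^sup>2 * (norm (eproj l w))\<^sup>2) (eigenvalues A)"
    unfolding infsetsum_altdef set_lebesgue_integral_def
    by (rule Bochner_Integration.integral_cong) (auto simp: indicator_def)
  also have "\<dots> = (norm (fun_calc A (\<lambda>l. indicator S l * f l) w))\<^sup>2"
    by (rule norm_fun_calc_infsetsum[OF assms, symmetric])
  finally show ?thesis .
qed

end

section \<open>Error and discrepancy of the regularization\<close>

lemma bounded_imageI: "(\<And>l. l \<in> L \<Longrightarrow> \<bar>f l\<bar> \<le> B) \<Longrightarrow> bounded (f ` L)"
  for f :: "real \<Rightarrow> real"
  unfolding bounded_iff by auto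

lemma s_fun_bounds:
  assumes "0 < \<alpha>" "0 \<le> t"
  shows "0 < s_fun \<alpha> t" "s_fun \<alpha> t \<le> 1" "s_fun \<alpha> t \<le> sqrt (s_fun \<alpha> t)" "s_fun \<alpha> t * t \<le> \<alpha>"
proof -
  show *: "0 < s_fun \<alpha> t" "s_fun \<alpha> t \<le> 1" "s_fun \<alpha> t * t \<le> \<alpha>"
    using assms by (auto simp: s_fun_def field_simps)
  have "(s_fun \<alpha> t)\<^sup>2 \<le> s_fun \<alpha> t"
    using * by (simp add: power2_eq_square mult_left_le)
  then show "s_fun \<alpha> t \<le> sqrt (s_fun \<alpha> t)"
    by (rule real_le_rsqrt)
qed

locale spectral_regularization = compact_gram_operator +
  fixes g :: "real \<Rightarrow> real \<Rightarrow> real" and \<gamma> :: real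
  assumes gamma: "1 \<le> \<gamma>" "\<And>\<alpha> t. 0 < \<alpha> \<Longrightarrow> t \<in> {0..onorm A} \<Longrightarrow> \<alpha> * \<bar>g \<alpha> t\<bar> \<le> \<gamma>"
    and residual_mono: "\<And>\<alpha> \<beta> t. 0 < \<alpha> \<Longrightarrow> \<alpha> \<le> \<beta> \<Longrightarrow> t \<in> {0..onorm A} \<Longrightarrow> residual g \<alpha> t \<le> residual g \<beta> t"
    and residual_bounds: "\<And>\<alpha> t. 0 < \<alpha> \<Longrightarrow> t \<in> {0..onorm A} \<Longrightarrow> 0 \<le> residual g \<alpha> t \<and> residual g \<alpha> t \<le> 1"
begin

lemma residual_abs_le:
  assumes "0 < \<alpha>" "l \<in> eigenvalues A"
  shows "\<bar>residual g \<alpha> l\<bar> \<le> 1"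
  using residual_bounds[OF assms(1) eigenvalue_bounds[OF assms(2)]] by simp

lemma bounded_residual: "0 < \<alpha> \<Longrightarrow> bounded (residual g \<alpha> ` eigenvalues A)"
  using residual_abs_le by (rule bounded_imageI)

text \<open>Sum of the two bounds \<open>\<alpha> \<bar>g\<bar> \<le> \<gamma>\<close> and \<open>l \<bar>g\<bar> \<le> 1\<close>.\<close>

lemma g_le:
  assumes "0 < \<alpha>" "l \<in> eigenvalues A"
  shows "\<bar>g \<alpha> l\<bar> \<le> \<bar>(2 * \<gamma> / \<alpha>) * sqrt (s_fun \<alpha> l)\<bar>"
proof -
  note l = eigenvalue_bounds[OF assms(2)]
  have "\<bar>l * g \<alpha> l\<bar> \<le> 1"
    using residual_bounds[OF assms(1) l] by (auto simp: residual_def)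
  then have "l * \<bar>g \<alpha> l\<bar> \<le> \<gamma>"
    using l gamma(1) by (simp add: abs_mult)
  then have "(l + \<alpha>) * \<bar>g \<alpha> l\<bar> \<le> 2 * \<gamma>"
    using gamma(2)[OF assms(1) l] by (simp add: distrib_right)
  then have "\<bar>g \<alpha> l\<bar> \<le> 2 * \<gamma> / (l + \<alpha>)"
    using assms(1) l by (simp add: pos_le_divide_eq mult.commute)
  also have "\<dots> = (2 * \<gamma> / \<alpha>) * s_fun \<alpha> l"
    using assms(1) by (simp add: s_fun_def)
  also have "\<dots> \<le> (2 * \<gamma> / \<alpha>) * sqrt (s_fun \<alpha> l)"
    using s_fun_bounds[OF assms(1), of l] l assms(1) gamma(1) by (intro mult_left_mono) auto
  finally show ?thesis by linarith
qed

lemma bounded_s: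
  assumes "0 < \<alpha>"
  shows "bounded (s_fun \<alpha> ` eigenvalues A)" "bounded ((\<lambda>t. sqrt (s_fun \<alpha> t)) ` eigenvalues A)"
  by (intro bounded_imageI[where B = 1];
      use s_fun_bounds[OF assms] eigenvalue_bounds in \<open>force\<close>)+

lemma bounded_g:
  assumes "0 < \<alpha>"
  shows "bounded (g \<alpha> ` eigenvalues A)"
proof (rule bounded_imageI)
  fix l assume "l \<in> eigenvalues A"
  then show "\<bar>g \<alpha> l\<bar> \<le> \<gamma> / \<alpha>"
    using gamma(2)[OF assms eigenvalue_bounds] assms by (simp add: field_simps)
qed

lemma bounded_s_residual:
  assumes "0 < \<alpha>"
  shows "bounded ((\<lambda>l. s_fun \<alpha> l * residual g \<alpha> l) ` eigenvalues A)"
    and "bounded ((\<lambda>l. s_fun \<alpha> l * l * residual g \<alpha> l) ` eigenvalues A)"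
proof -
  show "bounded ((\<lambda>l. s_fun \<alpha> l * residual g \<alpha> l) ` eigenvalues A)"
  proof (rule bounded_imageI)
    fix l assume l: "l \<in> eigenvalues A"
    show "\<bar>s_fun \<alpha> l * residual g \<alpha> l\<bar> \<le> 1 * 1"
      unfolding abs_mult using residual_abs_le[OF assms l] s_fun_bounds[OF assms, of l] eigenvalue_bounds[OF l]
      by (intro mult_mono) auto
  qed
  show "bounded ((\<lambda>l. s_fun \<alpha> l * l * residual g \<alpha> l) ` eigenvalues A)"
  proof (rule bounded_imageI)
    fix l assume l: "l \<in> eigenvalues A"
    have "\<bar>s_fun \<alpha> l * l\<bar> \<le> \<alpha>"
      using s_fun_bounds[OF assms, of l] eigenvalue_bounds[OF l] by simp
    then show "\<bar>s_fun \<alpha> l * l * residual g \<alpha> l\<bar> \<le> \<alpha> * 1"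
      unfolding abs_mult[of "_ * _"] using residual_abs_le[OF assms l] assms
      by (intro mult_mono) auto
  qed
qed

section \<open>Bias and noise in the error and in the discrepancy\<close>

text \<open>On the eigenspace of \<open>l\<close> this is the identity
  \<open>1 - l * g \<alpha> l = residual g \<alpha> l\<close>.\<close>

lemma reg_solution_error:
  assumes "0 < \<alpha>"
  shows "reg_solution A g x0 (A xd + \<delta> *\<^sub>R \<zeta>) \<alpha> - xd
    = \<delta> *\<^sub>R fun_calc A (g \<alpha>) \<zeta> - fun_calc A (residual g \<alpha>) (xd - x0)"
  by (rule eproj_eq_imp_eq)
     (simp add: reg_solution_def eproj_diff eproj_add eproj_scaleR eproj_A
       eproj_fun_calc bounded_g bounded_residual assms, simp add: residual_def algebra_simps)

text \<open>Componentwise, \<open>A\<close> applied to the regularized solution minus the data is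
  the residual times \<open>l * x0\<close> minus the data, which separates noise from bias.\<close>

lemma discrepancy_eq:
  assumes "0 < \<alpha>"
  shows "fun_calc A (s_fun \<alpha>) (A (reg_solution A g x0 (A xd + \<delta> *\<^sub>R \<zeta>) \<alpha>) - (A xd + \<delta> *\<^sub>R \<zeta>))
    = - (\<delta> *\<^sub>R fun_calc A (\<lambda>l. s_fun \<alpha> l * residual g \<alpha> l) \<zeta>
         + fun_calc A (\<lambda>l. s_fun \<alpha> l * l * residual g \<alpha> l) (xd - x0))"
  by (rule eproj_eq_imp_eq)
     (simp add: reg_solution_def eproj_diff eproj_add eproj_scaleR eproj_A eproj_minus
       eproj_fun_calc bounded_g bounded_residual bounded_s bounded_s_residual assms,
      simp add: residual_def algebra_simps)

definition bias :: "'a \<Rightarrow> real \<Rightarrow> real" where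
  "bias w \<alpha> = norm (fun_calc A (residual g \<alpha>) w)"

text \<open>For \<open>w = xd - x0\<close> this is the norm tested by the RG-rule in the case of
  exact data.\<close>

definition bias_discrepancy :: "'a \<Rightarrow> real \<Rightarrow> real" where
  "bias_discrepancy w \<alpha> = norm (fun_calc A (\<lambda>l. s_fun \<alpha> l * l * residual g \<alpha> l) w)"

lemma exact_error:
  assumes "0 < \<alpha>"
  shows "norm (reg_solution A g x0 (A xd) \<alpha> - xd) = bias (xd - x0) \<alpha>"
  using reg_solution_error[OF assms, of x0 xd 0] by (simp add: bias_def)

lemma bias_mono:
  assumes "0 < \<alpha>" "\<alpha> \<le> \<beta>"
  shows "bias w \<alpha> \<le> bias w \<beta>"
  unfolding bias_def
proof (rule norm_fun_calc_mono)
  fix l assume "l \<in> eigenvalues A"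
  note l = eigenvalue_bounds[OF this]
  show "\<bar>residual g \<alpha> l\<bar> \<le> \<bar>residual g \<beta> l\<bar>"
    using residual_mono[OF assms l] residual_bounds[OF assms(1) l] by simp
qed (use bounded_residual assms in simp)

lemma bias_le_norm:
  assumes "0 < \<alpha>"
  shows "bias w \<alpha> \<le> norm w"
proof -
  have "bias w \<alpha> \<le> norm (fun_calc A (\<lambda>_. 1) w)"
    unfolding bias_def by (rule norm_fun_calc_mono) (use residual_abs_le[OF assms] in \<open>auto simp: image_constant_conv\<close>)
  then show ?thesis by (simp add: fun_calc_const_1)
qed

lemma bias_discrepancy_le:
  assumes "0 < \<alpha>"
  shows "bias_discrepancy w \<alpha> \<le> \<alpha> * bias w \<alpha>"
proof -
  have "bias_discrepancy w \<alpha> \<le> norm (fun_calc A (\<lambda>l. \<alpha> * residual g \<alpha> l) w)"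
    unfolding bias_discrepancy_def
  proof (rule norm_fun_calc_mono)
    fix l assume l: "l \<in> eigenvalues A"
    show "\<bar>s_fun \<alpha> l * l * residual g \<alpha> l\<bar> \<le> \<bar>\<alpha> * residual g \<alpha> l\<bar>"
      unfolding abs_mult[of _ "residual g \<alpha> l"]
      using s_fun_bounds[OF assms, of l] eigenvalue_bounds[OF l] by (intro mult_right_mono) auto
  next
    show "bounded ((\<lambda>l. \<alpha> * residual g \<alpha> l) ` eigenvalues A)"
      using bounded_scaleR_comp[OF bounded_residual[OF assms], of \<alpha>] by simp
  qed
  then show ?thesis
    using assms by (simp add: fun_calc_scale bounded_residual bias_def)
qed

text \<open>The bound \<open>g_le\<close> passes to norms and replaces \<open>g \<alpha>\<close> by
  a multiple of the square root of \<open>s_fun \<alpha>\<close>, the weight in which the noise is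
  controlled.\<close>

lemma total_error_le:
  assumes "0 < \<alpha>" "0 < \<delta>" "\<delta> * norm (fun_calc A (\<lambda>t. sqrt (s_fun \<alpha> t)) \<zeta>) \<le> D"
  shows "norm (reg_solution A g x0 (A xd + \<delta> *\<^sub>R \<zeta>) \<alpha> - xd) \<le> bias (xd - x0) \<alpha> + 2 * \<gamma> * (D / \<alpha>)"
proof -
  have bd: "bounded ((\<lambda>l. (2 * \<gamma> / \<alpha>) * sqrt (s_fun \<alpha> l)) ` eigenvalues A)"
    using bounded_scaleR_comp[OF bounded_s(2)[OF assms(1)], of "2 * \<gamma> / \<alpha>"] by simp
  have "norm (fun_calc A (g \<alpha>) \<zeta>) \<le> norm (fun_calc A (\<lambda>l. (2 * \<gamma> / \<alpha>) * sqrt (s_fun \<alpha> l)) \<zeta>)"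
    by (rule norm_fun_calc_mono[OF g_le[OF assms(1)] bd])
  also have "\<dots> = (2 * \<gamma> / \<alpha>) * norm (fun_calc A (\<lambda>t. sqrt (s_fun \<alpha> t)) \<zeta>)"
    using assms(1) gamma(1) by (subst fun_calc_scale[OF bounded_s(2)[OF assms(1)]]) simp
  finally have "\<delta> * norm (fun_calc A (g \<alpha>) \<zeta>)
      \<le> (2 * \<gamma> / \<alpha>) * (\<delta> * norm (fun_calc A (\<lambda>t. sqrt (s_fun \<alpha> t)) \<zeta>))"
    using mult_left_mono assms(2) by (metis less_imp_le mult.left_commute)
  also have "\<dots> \<le> (2 * \<gamma> / \<alpha>) * D"
    using assms gamma(1) by (intro mult_left_mono) auto
  finally have "\<delta> * norm (fun_calc A (g \<alpha>) \<zeta>) \<le> 2 * \<gamma> * (D / \<alpha>)" by simp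
  then show ?thesis
    unfolding reg_solution_error[OF assms(1)] bias_def
    using norm_triangle_ineq4[of "\<delta> *\<^sub>R fun_calc A (g \<alpha>) \<zeta>" "fun_calc A (residual g \<alpha>) (xd - x0)"] assms(2)
    by simp
qed

lemma
  fixes x0 xd \<zeta> :: 'a and \<delta> \<alpha> :: real
  defines "disc \<equiv> norm (fun_calc A (s_fun \<alpha>) (A (reg_solution A g x0 (A xd + \<delta> *\<^sub>R \<zeta>) \<alpha>) - (A xd + \<delta> *\<^sub>R \<zeta>)))"
  assumes "0 < \<alpha>" "0 < \<delta>" "\<delta> * norm (fun_calc A (\<lambda>t. sqrt (s_fun \<alpha> t)) \<zeta>) \<le> D"
  shows discrepancy_upper: "disc \<le> bias_discrepancy (xd - x0) \<alpha> + D"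
    and discrepancy_lower: "bias_discrepancy (xd - x0) \<alpha> \<le> disc + D"
proof -
  let ?n = "\<delta> *\<^sub>R fun_calc A (\<lambda>l. s_fun \<alpha> l * residual g \<alpha> l) \<zeta>"
  let ?b = "fun_calc A (\<lambda>l. s_fun \<alpha> l * l * residual g \<alpha> l) (xd - x0)"
  \<comment> \<open>The noise part of the discrepancy has constant exactly 1, since the residual is
    at most 1 and \<open>s_fun\<close> is at most its square root; this is why every \<tau> > 1
    suffices.\<close>
  have "norm (fun_calc A (\<lambda>l. s_fun \<alpha> l * residual g \<alpha> l) \<zeta>) \<le> norm (fun_calc A (\<lambda>t. sqrt (s_fun \<alpha> t)) \<zeta>)"
  proof (rule norm_fun_calc_mono)
    fix l assume l: "l \<in> eigenvalues A"
    have "s_fun \<alpha> l * \<bar>residual g \<alpha> l\<bar> \<le> sqrt (s_fun \<alpha> l) * 1"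
      using s_fun_bounds[OF assms(2), of l] eigenvalue_bounds[OF l] residual_abs_le[OF assms(2) l]
      by (intro mult_mono) auto
    then show "\<bar>s_fun \<alpha> l * residual g \<alpha> l\<bar> \<le> \<bar>sqrt (s_fun \<alpha> l)\<bar>"
      using s_fun_bounds[OF assms(2), of l] eigenvalue_bounds[OF l] by (simp add: abs_mult)
  qed (rule bounded_s(2)[OF assms(2)])
  then have "norm ?n \<le> \<delta> * norm (fun_calc A (\<lambda>t. sqrt (s_fun \<alpha> t)) \<zeta>)"
    using assms(3) by simp
  with assms(4) have n: "norm ?n \<le> D" by simp
  have disc: "disc = norm (?n + ?b)"
    unfolding disc_def discrepancy_eq[OF assms(2)] by (rule norm_minus_cancel)
  show "disc \<le> bias_discrepancy (xd - x0) \<alpha> + D"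
    unfolding disc bias_discrepancy_def using norm_triangle_ineq[of ?n ?b] n by simp
  show "bias_discrepancy (xd - x0) \<alpha> \<le> disc + D"
    unfolding disc bias_discrepancy_def using norm_triangle_ineq4[of "?n + ?b" ?n] n by simp
qed

text \<open>On \<open>t \<ge> c2 \<kappa>\<close> with \<open>\<kappa> = min \<alpha> t0\<close> the factor \<open>t s_\<alpha>(t)\<close> is bounded below by a
  multiple of \<open>\<alpha>\<close>, and the source condition at \<open>\<kappa>\<close> controls the remaining low frequencies.\<close>

lemma bias_le_bias_discrepancy:
  assumes c2: "0 < c2" "c2 < 1" and t0: "0 < t0" and \<alpha>: "0 < \<alpha>" "\<alpha> \<le> \<alpha>0"
    and source: "\<forall>\<alpha>. 0 < \<alpha> \<and> \<alpha> \<le> t0 \<longrightarrow>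
           (LINT t:{0..<\<alpha>}|spectral_measure A w. 1)
             \<le> c1\<^sup>2 * (LINT t:{c2 * \<alpha>..}|spectral_measure A w. (residual g \<alpha> t)\<^sup>2)"
  defines "m \<equiv> c2 * min 1 (t0 / \<alpha>0)"
  shows "bias w \<alpha> \<le> sqrt (1 + c1\<^sup>2) * ((m + 1) / m) * (bias_discrepancy w \<alpha> / \<alpha>)"
proof -
  define \<kappa> where "\<kappa> = min \<alpha> t0"
  have \<kappa>: "0 < \<kappa>" "\<kappa> \<le> t0" "\<kappa> \<le> \<alpha>" using t0 \<alpha> by (auto simp: \<kappa>_def)
  have "m > 0" using c2 t0 \<alpha> by (simp add: m_def)
  \<comment> \<open>This makes \<open>m\<close> a constant independent of \<alpha> with
    \<open>m * \<alpha>\<close> below the cut-off \<open>c2 * \<kappa>\<close>, including for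
    \<alpha> beyond \<open>t0\<close>.\<close>
  have "min 1 (t0 / \<alpha>0) * \<alpha> \<le> \<kappa>"
  proof -
    have "t0 / \<alpha>0 * \<alpha> \<le> t0" using \<alpha> t0 by (simp add: field_simps)
    moreover have "min 1 (t0 / \<alpha>0) * \<alpha> \<le> 1 * \<alpha>" "min 1 (t0 / \<alpha>0) * \<alpha> \<le> t0 / \<alpha>0 * \<alpha>"
      using \<alpha> by (intro mult_right_mono; simp)+
    ultimately show ?thesis by (simp add: \<kappa>_def)
  qed
  then have m\<alpha>: "m * \<alpha> \<le> c2 * \<kappa>"
    using c2 by (simp add: m_def mult.assoc)
  define low where "low = (\<lambda>l. indicat_real {0..<\<kappa>} l * 1)"
  define high where "high = (\<lambda>\<beta> l. indicat_real {c2 * \<kappa>..} l * residual g \<beta> l)"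
  have high_le: "\<bar>high \<beta> l\<bar> \<le> 1" if "0 < \<beta>" "l \<in> eigenvalues A" for \<beta> l
    using residual_abs_le[OF that] by (simp add: high_def indicator_def)
  have bd: "bounded (low ` eigenvalues A)" "\<And>\<beta>. 0 < \<beta> \<Longrightarrow> bounded (high \<beta> ` eigenvalues A)"
    by (rule bounded_imageI[where B = 1], simp add: low_def indicator_def)
       (rule bounded_imageI[OF high_le])
  have "(norm (fun_calc A low w))\<^sup>2 = (LINT t:{0..<\<kappa>}|spectral_measure A w. 1)"
    using set_integral_spectral_measure[of "{0..<\<kappa>}" "\<lambda>_. 1" w] bd(1) by (simp add: low_def)
  also have "\<dots> \<le> c1\<^sup>2 * (LINT t:{c2 * \<kappa>..}|spectral_measure A w. (residual g \<kappa> t)\<^sup>2)"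
    using source \<kappa> by blast
  also have "\<dots> = c1\<^sup>2 * (norm (fun_calc A (high \<kappa>) w))\<^sup>2"
    using set_integral_spectral_measure[of "{c2 * \<kappa>..}" "residual g \<kappa>" w] bd(2)[OF \<kappa>(1)]
    by (simp add: high_def)
  \<comment> \<open>Only the residual passes from \<kappa> to \<alpha>, by monotonicity; the cut-off
    stays at \<open>c2 * \<kappa>\<close>.\<close>
  also have "\<dots> \<le> c1\<^sup>2 * (norm (fun_calc A (high \<alpha>) w))\<^sup>2"
  proof (intro mult_left_mono power_mono norm_fun_calc_mono bd(2)[OF \<alpha>(1)])
    fix l assume "l \<in> eigenvalues A"
    note l = eigenvalue_bounds[OF this]
    show "\<bar>high \<kappa> l\<bar> \<le> \<bar>high \<alpha> l\<bar>"
      using residual_mono[OF \<kappa>(1,3) l] residual_bounds[OF \<kappa>(1) l] by (simp add: high_def indicator_def)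
  qed auto
  finally have low_le: "(norm (fun_calc A low w))\<^sup>2 \<le> c1\<^sup>2 * (norm (fun_calc A (high \<alpha>) w))\<^sup>2" .
  have "(bias w \<alpha>)\<^sup>2 \<le> (norm (fun_calc A low w))\<^sup>2 + (norm (fun_calc A (high \<alpha>) w))\<^sup>2"
    unfolding bias_def
  proof (rule fun_calc_sum_squares_le[OF _ bounded_residual[OF \<alpha>(1)] bd(1) bd(2)[OF \<alpha>(1)]])
    fix l assume l: "l \<in> eigenvalues A"
    have r: "(residual g \<alpha> l)\<^sup>2 \<le> 1"
      using residual_abs_le[OF \<alpha>(1) l] by (simp add: abs_square_le_1)
    \<comment> \<open>The low and high ranges overlap, so together they contain every
      eigenvalue.\<close>
    have "c2 * \<kappa> < \<kappa>" using c2 \<kappa> by simp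
    then show "(residual g \<alpha> l)\<^sup>2 \<le> (low l)\<^sup>2 + (high \<alpha> l)\<^sup>2"
      using r eigenvalue_bounds[OF l] by (auto simp: low_def high_def indicator_def)
  qed
  with low_le have "(bias w \<alpha>)\<^sup>2 \<le> (1 + c1\<^sup>2) * (norm (fun_calc A (high \<alpha>) w))\<^sup>2"
    by (simp add: distrib_right)
  then have "(bias w \<alpha>)\<^sup>2 \<le> (sqrt (1 + c1\<^sup>2) * norm (fun_calc A (high \<alpha>) w))\<^sup>2"
    by (simp add: power_mult_distrib)
  then have bias_high: "bias w \<alpha> \<le> sqrt (1 + c1\<^sup>2) * norm (fun_calc A (high \<alpha>) w)"
    by (rule power2_le_imp_le) simp
  \<comment> \<open>The reciprocal of \<open>s_fun \<alpha> t * t\<close> at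
    \<open>t = m * \<alpha>\<close>; as this product increases with \<open>t\<close>, multiplying it
    by \<open>k\<close> gives at least 1 above the cut-off.\<close>
  define k where "k = (m + 1) / (m * \<alpha>)"
  have "k > 0" using \<open>m > 0\<close> \<alpha> by (simp add: k_def)
  have "norm (fun_calc A (high \<alpha>) w) \<le> norm (fun_calc A (\<lambda>l. k * (s_fun \<alpha> l * l * residual g \<alpha> l)) w)"
  proof (rule norm_fun_calc_mono)
    show "bounded ((\<lambda>l. k * (s_fun \<alpha> l * l * residual g \<alpha> l)) ` eigenvalues A)"
      using bounded_scaleR_comp[OF bounded_s_residual(2)[OF \<alpha>(1)], of k] by simp
    fix l assume l: "l \<in> eigenvalues A"
    show "\<bar>high \<alpha> l\<bar> \<le> \<bar>k * (s_fun \<alpha> l * l * residual g \<alpha> l)\<bar>"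
    proof (cases "c2 * \<kappa> \<le> l")
      case True
      then have "m * \<alpha> \<le> l" using m\<alpha> by linarith
      moreover have "0 \<le> l" using eigenvalue_bounds[OF l] by simp
      ultimately have "m * (l + \<alpha>) \<le> (m + 1) * l" by (simp add: algebra_simps)
      then have "1 \<le> ((m + 1) * l) / (m * (l + \<alpha>))"
        using \<open>m > 0\<close> \<alpha> \<open>0 \<le> l\<close> by (simp add: le_divide_eq_1)
      also have "\<dots> = k * (s_fun \<alpha> l * l)"
        using \<alpha> by (simp add: k_def s_fun_def)
      finally have "1 \<le> k * (s_fun \<alpha> l * l)" .
      then have "1 * \<bar>residual g \<alpha> l\<bar> \<le> \<bar>k * (s_fun \<alpha> l * l)\<bar> * \<bar>residual g \<alpha> l\<bar>"
        by (intro mult_right_mono) auto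
      then show ?thesis
        using True by (simp add: high_def abs_mult mult.assoc)
    qed (simp add: high_def)
  qed
  also have "\<dots> = k * bias_discrepancy w \<alpha>"
    using \<open>k > 0\<close> by (subst fun_calc_scale[OF bounded_s_residual(2)[OF \<alpha>(1)]])
      (simp add: bias_discrepancy_def)
  finally have "norm (fun_calc A (high \<alpha>) w) \<le> ((m + 1) / m) * (bias_discrepancy w \<alpha> / \<alpha>)"
    by (simp add: k_def)
  then have "sqrt (1 + c1\<^sup>2) * norm (fun_calc A (high \<alpha>) w)
      \<le> sqrt (1 + c1\<^sup>2) * (((m + 1) / m) * (bias_discrepancy w \<alpha> / \<alpha>))"
    by (rule mult_left_mono) simp
  with bias_high show ?thesis by (simp only: mult.assoc)
qed

end

section \<open>Parameter choice\<close>

text \<open>The grid decreases in the exponent, so the least exponent occurring in \<open>X\<close>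
  gives its maximum.\<close>

lemma grid_Greatest:
  assumes "X \<subseteq> grid q \<alpha>0" "X \<noteq> {}" "0 < q" "q < 1" "0 < \<alpha>0"
  shows "(GREATEST \<alpha>. \<alpha> \<in> X) \<in> X" "\<And>\<beta>. \<beta> \<in> X \<Longrightarrow> \<beta> \<le> (GREATEST \<alpha>. \<alpha> \<in> X)"
proof -
  define k where "k = (LEAST k. q ^ k * \<alpha>0 \<in> X)"
  have "\<exists>k. q ^ k * \<alpha>0 \<in> X"
    using assms(1,2) unfolding grid_def by blast
  then have k: "q ^ k * \<alpha>0 \<in> X"
    unfolding k_def by (rule LeastI_ex)
  have le: "\<beta> \<le> q ^ k * \<alpha>0" if "\<beta> \<in> X" for \<beta>
  proof -
    have "\<beta> \<in> grid q \<alpha>0" using that assms(1) by blast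
    then obtain j where j: "\<beta> = q ^ j * \<alpha>0" by (auto simp: grid_def)
    then have "k \<le> j"
      using that unfolding k_def by (intro Least_le) simp
    then show ?thesis
      using j assms(3-5) by (simp add: power_decreasing)
  qed
  have "(GREATEST \<alpha>. \<alpha> \<in> X) = q ^ k * \<alpha>0"
    by (rule Greatest_equality) (use k le in auto)
  with k le show "(GREATEST \<alpha>. \<alpha> \<in> X) \<in> X" "\<And>\<beta>. \<beta> \<in> X \<Longrightarrow> \<beta> \<le> (GREATEST \<alpha>. \<alpha> \<in> X)"
    by auto
qed

section \<open>Noise levels and the abstract parameter choice\<close>

locale noise_level =
  fixes d :: "real \<Rightarrow> real"
  assumes d_pos: "0 < \<alpha> \<Longrightarrow> 0 < d \<alpha>"
    and d_mono: "mono_on {0<..} d"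
    and d_anti: "antimono_on {0<..} (\<lambda>\<alpha>. d \<alpha> / sqrt \<alpha>)"
begin

lemma d_le: "0 < \<alpha> \<Longrightarrow> \<alpha> \<le> \<beta> \<Longrightarrow> d \<alpha> \<le> d \<beta>"
  using d_mono by (auto simp: monotone_on_def)

lemma d_quotient_le:
  assumes "0 < \<alpha>" "\<alpha> \<le> \<beta>"
  shows "d \<beta> / \<beta> \<le> d \<alpha> / \<alpha>"
proof -
  have "(d \<beta> / sqrt \<beta>) * (1 / sqrt \<beta>) \<le> (d \<alpha> / sqrt \<alpha>) * (1 / sqrt \<alpha>)"
  proof (rule mult_mono)
    show "d \<beta> / sqrt \<beta> \<le> d \<alpha> / sqrt \<alpha>"
      using d_anti assms by (auto simp: monotone_on_def)
    show "1 / sqrt \<beta> \<le> 1 / sqrt \<alpha>"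
      using assms by (intro divide_left_mono) auto
    show "0 \<le> d \<alpha> / sqrt \<alpha>"
      using d_pos[of \<alpha>] assms by simp
  qed (use assms in auto)
  then show ?thesis using assms by simp
qed

text \<open>Since \<open>d \<alpha> / sqrt \<alpha>\<close> is at least its value \<open>c\<close>
  at \<open>\<alpha>0\<close>, a grid point qualifies as soon as
  \<open>sqrt \<alpha> \<le> \<eta> * c\<close>, which holds far enough down the grid.\<close>

lemma alpha_hat_props:
  assumes "0 < q" "q < 1" "0 < \<alpha>0" "0 < \<eta>"
  shows "alpha_hat q \<alpha>0 \<eta> d \<in> grid q \<alpha>0" "alpha_hat q \<alpha>0 \<eta> d \<le> \<eta> * d (alpha_hat q \<alpha>0 \<eta> d)"
proof -
  define X where "X = {\<alpha>. \<alpha> \<in> grid q \<alpha>0 \<and> \<alpha> \<le> \<eta> * d \<alpha>}"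
  define c where "c = d \<alpha>0 / sqrt \<alpha>0"
  have "c > 0" using d_pos assms by (simp add: c_def)
  then obtain k where k: "q ^ k < (\<eta> * c)\<^sup>2 / \<alpha>0"
    using real_arch_pow_inv[of "(\<eta> * c)\<^sup>2 / \<alpha>0" q] assms by auto
  define \<alpha> where "\<alpha> = q ^ k * \<alpha>0"
  have \<alpha>: "0 < \<alpha>" "\<alpha> \<le> \<alpha>0" "\<alpha> \<in> grid q \<alpha>0"
    using assms by (auto simp: \<alpha>_def grid_def power_le_one)
  have "\<alpha> \<le> (\<eta> * c)\<^sup>2"
    using k assms by (simp add: \<alpha>_def field_simps)
  then have "sqrt \<alpha> \<le> \<eta> * c"
    using \<open>c > 0\<close> assms by (intro real_le_lsqrt) auto
  then have "sqrt \<alpha> * sqrt \<alpha> \<le> (\<eta> * c) * sqrt \<alpha>"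
    using \<alpha>(1) by (intro mult_right_mono) auto
  then have "\<alpha> \<le> (\<eta> * c) * sqrt \<alpha>"
    using \<alpha>(1) by simp
  moreover have "c \<le> d \<alpha> / sqrt \<alpha>"
    using d_anti \<alpha> assms by (auto simp: monotone_on_def c_def)
  then have "\<eta> * (c * sqrt \<alpha>) \<le> \<eta> * d \<alpha>"
    using \<alpha>(1) assms by (intro mult_left_mono) (auto simp: field_simps)
  ultimately have "\<alpha> \<in> X"
    using \<alpha> by (simp add: X_def mult.assoc)
  then have "(GREATEST \<alpha>. \<alpha> \<in> X) \<in> X"
    by (intro grid_Greatest(1)[OF _ _ assms(1-3)]) (auto simp: X_def)
  moreover have "alpha_hat q \<alpha>0 \<eta> d = (GREATEST \<alpha>. \<alpha> \<in> X)"
    by (simp add: alpha_hat_def X_def)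
  ultimately show "alpha_hat q \<alpha>0 \<eta> d \<in> grid q \<alpha>0" "alpha_hat q \<alpha>0 \<eta> d \<le> \<eta> * d (alpha_hat q \<alpha>0 \<eta> d)"
    by (auto simp: X_def)
qed

text \<open>The rule with the operators abstracted away: \<open>e\<close> is the bias,
  \<open>R\<close> the discrepancy for exact data, \<open>disc\<close> the measured discrepancy,
  \<open>err\<close> the total error, and \<open>W\<close> a uniform bound of the bias. Noise and
  bias at the chosen \<open>as\<close> are estimated separately, according to the position of
  \<open>as\<close> relative to \<alpha>.\<close>

lemma discrepancy_quasi_optimal:
  fixes e R err disc :: "real \<Rightarrow> real" and \<alpha>0 q \<tau> \<eta> c K W :: real
  defines "ah \<equiv> alpha_hat q \<alpha>0 \<eta> d"
  defines "Adm \<equiv> {\<alpha> \<in> grid q \<alpha>0. ah \<le> \<alpha> \<and> disc \<alpha> \<le> \<tau> * d \<alpha>}"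
  defines "as \<equiv> (if Adm = {} then ah else (GREATEST \<alpha>. \<alpha> \<in> Adm))"
  assumes params: "0 < q" "q < 1" "0 < \<alpha>0" "0 < \<eta>" "1 < \<tau>" "0 \<le> c" "0 \<le> K" "0 \<le> W"
    and e_nonneg: "\<And>\<alpha>. 0 < \<alpha> \<Longrightarrow> 0 \<le> e \<alpha>"
    and e_mono: "\<And>\<alpha> \<beta>. 0 < \<alpha> \<Longrightarrow> \<alpha> \<le> \<beta> \<Longrightarrow> e \<alpha> \<le> e \<beta>"
    and e_bound: "\<And>\<alpha>. 0 < \<alpha> \<Longrightarrow> e \<alpha> \<le> W"
    and err: "\<And>\<alpha>. \<alpha> \<in> grid q \<alpha>0 \<Longrightarrow> ah \<le> \<alpha> \<Longrightarrow> err \<alpha> \<le> e \<alpha> + c * (d \<alpha> / \<alpha>)"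
    and R_le: "\<And>\<alpha>. \<alpha> \<in> grid q \<alpha>0 \<Longrightarrow> ah \<le> \<alpha> \<Longrightarrow> R \<alpha> \<le> disc \<alpha> + d \<alpha>"
    and disc_le: "\<And>\<alpha>. \<alpha> \<in> grid q \<alpha>0 \<Longrightarrow> ah \<le> \<alpha> \<Longrightarrow> disc \<alpha> \<le> R \<alpha> + d \<alpha>"
    and R_upper: "\<And>\<alpha>. 0 < \<alpha> \<Longrightarrow> R \<alpha> \<le> \<alpha> * e \<alpha>"
    and R_lower: "\<And>\<alpha>. 0 < \<alpha> \<Longrightarrow> \<alpha> \<le> \<alpha>0 \<Longrightarrow> e \<alpha> \<le> K * (R \<alpha> / \<alpha>)"
    and \<alpha>: "0 < \<alpha>" "\<alpha> \<le> \<alpha>0"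
  shows "err as \<le> (1 + W * \<eta> + K * (\<tau> + 1) + c * (1 + 1 / q + 1 / (q * (\<tau> - 1)))) * (e \<alpha> + d \<alpha> / \<alpha>)"
proof -
  let ?\<Phi> = "e \<alpha> + d \<alpha> / \<alpha>"
  have Adm_grid: "Adm \<subseteq> grid q \<alpha>0" by (auto simp: Adm_def)
  note ah = alpha_hat_props[OF params(1-4), folded ah_def]
  note Great = grid_Greatest[OF Adm_grid _ params(1-3)]
  have as_cases: "as \<in> Adm \<or> as = ah"
    using Great(1) by (auto simp: as_def)
  then have as: "as \<in> grid q \<alpha>0" "ah \<le> as"
    using ah(1) by (auto simp: Adm_def)
  then have as_pos: "0 < as" "as \<le> \<alpha>0"
    using params by (auto simp: grid_def mult_le_cancel_right1 power_le_one)
  have maximal: "\<beta> \<le> as" if "\<beta> \<in> Adm" for \<beta>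
    using Great(2)[OF _ that] that by (auto simp: as_def)
  have e_le: "e \<alpha> \<le> ?\<Phi>" and d_le_\<Phi>: "d \<alpha> / \<alpha> \<le> ?\<Phi>" and \<Phi>_pos: "0 \<le> ?\<Phi>"
    using e_nonneg[OF \<alpha>(1)] d_pos[OF \<alpha>(1)] \<alpha>(1) by auto
  have next_point: "d as / as \<le> (1 / q) * (d \<alpha> / \<alpha>) + 1 / (q * (\<tau> - 1)) * e \<alpha>" if "as < \<alpha>"
  proof -
    obtain k where k: "as = q ^ k * \<alpha>0"
      using as(1) by (auto simp: grid_def)
    \<comment> \<open>As \<open>as < \<alpha> \<le> \<alpha>0\<close>, the chosen point is not the
      top of the grid, so a next larger grid point \<open>\<beta> = as / q\<close> exists.\<close>
    with that \<alpha> obtain j where j: "k = Suc j" by (cases k) auto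
    define \<beta> where "\<beta> = q ^ j * \<alpha>0"
    have \<beta>: "as = q * \<beta>" "0 < \<beta>" "\<beta> \<in> grid q \<alpha>0"
      using k j params by (auto simp: \<beta>_def grid_def)
    then have "as < \<beta>" using params by simp
    have tail_nonneg: "0 \<le> 1 / (q * (\<tau> - 1)) * e \<alpha>" "0 \<le> (1 / q) * (d \<alpha> / \<alpha>)"
      using params e_nonneg[OF \<alpha>(1)] d_pos[OF \<alpha>(1)] \<alpha>(1) by auto
    show ?thesis
    proof (cases "\<alpha> < \<beta>")
      case True
      \<comment> \<open>Here \<alpha> lies between neighbouring grid points, so \<open>as\<close> is
        at least \<open>q * \<alpha>\<close> and monotonicity of \<open>d\<close> suffices.\<close>
      have "d as / as \<le> d \<alpha> / as"
        using d_le[OF as_pos(1)] that as_pos by (intro divide_right_mono) auto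
      also have "\<dots> \<le> d \<alpha> / (q * \<alpha>)"
        using \<beta>(1) True params \<alpha>(1) d_pos[OF \<alpha>(1)] as_pos by (intro divide_left_mono) auto
      finally show ?thesis using tail_nonneg(1) by simp
    next
      case False
      \<comment> \<open>The rule rejected \<open>\<beta>\<close>, whether or not any parameter was
        admissible. The excess \<open>\<tau> - 1\<close> then bounds the noise level at
        \<open>\<beta>\<close> by the bias there, which is at most the bias at \<alpha>.\<close>
      have "\<beta> \<notin> Adm" using maximal \<open>as < \<beta>\<close> by force
      then have "\<tau> * d \<beta> < disc \<beta>"
        using \<beta>(3) as(2) \<open>as < \<beta>\<close> by (auto simp: Adm_def)
      also have "\<dots> \<le> \<beta> * e \<beta> + d \<beta>"
        using disc_le[of \<beta>] R_upper[of \<beta>] \<beta> as(2) \<open>as < \<beta>\<close> by simp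
      also have "\<dots> \<le> \<beta> * e \<alpha> + d \<beta>"
        using e_mono[of \<beta> \<alpha>] \<beta>(2) False by simp
      finally have "(\<tau> - 1) * d \<beta> \<le> \<beta> * e \<alpha>"
        by (simp add: algebra_simps)
      then have d\<beta>: "d \<beta> / \<beta> \<le> e \<alpha> / (\<tau> - 1)"
        using \<beta>(2) params by (simp add: field_simps)
      have "d as / as \<le> d \<beta> / as"
        using d_le[OF as_pos(1)] \<open>as < \<beta>\<close> as_pos by (intro divide_right_mono) auto
      also have "\<dots> = (1 / q) * (d \<beta> / \<beta>)" using \<beta>(1) by simp
      also have "\<dots> \<le> (1 / q) * (e \<alpha> / (\<tau> - 1))"
        using d\<beta> params by (intro mult_left_mono) auto
      finally show ?thesis using tail_nonneg(2) by simp
    qed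
  qed
  have noise: "d as / as \<le> (1 + 1 / q + 1 / (q * (\<tau> - 1))) * ?\<Phi>"
  proof (cases "\<alpha> \<le> as")
    case True
    have "d as / as \<le> 1 * ?\<Phi>"
      using d_quotient_le[OF \<alpha>(1) True] d_le_\<Phi> by simp
    also have "\<dots> \<le> (1 + 1 / q + 1 / (q * (\<tau> - 1))) * ?\<Phi>"
      using params \<Phi>_pos by (intro mult_right_mono) auto
    finally show ?thesis .
  next
    case False
    then have "d as / as \<le> (1 / q) * (d \<alpha> / \<alpha>) + 1 / (q * (\<tau> - 1)) * e \<alpha>"
      by (intro next_point) simp
    also have "\<dots> \<le> (1 / q) * ?\<Phi> + 1 / (q * (\<tau> - 1)) * ?\<Phi>"
      using params by (intro add_mono mult_left_mono d_le_\<Phi> e_le) auto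
    also have "\<dots> \<le> (1 + 1 / q + 1 / (q * (\<tau> - 1))) * ?\<Phi>"
      using \<Phi>_pos by (simp only: distrib_right mult_1)
    finally show ?thesis .
  qed
  have bias: "e as \<le> (1 + W * \<eta> + K * (\<tau> + 1)) * ?\<Phi>"
  proof (cases "\<alpha> < as")
    case False
    then have "e as \<le> 1 * ?\<Phi>"
      using e_mono[OF as_pos(1), of \<alpha>] e_le by simp
    also have "\<dots> \<le> (1 + W * \<eta> + K * (\<tau> + 1)) * ?\<Phi>"
      using params \<Phi>_pos by (intro mult_right_mono) auto
    finally show ?thesis .
  next
    case True
    \<comment> \<open>For \<alpha> below \<open>as\<close> the bias may be larger at
      \<open>as\<close>, so it is bounded by the noise term at \<open>as\<close>, which in turn is
      at most the one at \<alpha>.\<close>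
    then have dq: "d as / as \<le> ?\<Phi>"
      using d_quotient_le[OF \<alpha>(1), of as] d_le_\<Phi> by simp
    consider "as \<in> Adm" | "as = ah" using as_cases by blast
    then have "e as \<le> (W * \<eta> + K * (\<tau> + 1)) * (d as / as)"
    proof cases
      case 1
      then have "R as \<le> (\<tau> + 1) * d as"
        using R_le[OF as] by (simp add: Adm_def algebra_simps)
      then have "R as / as \<le> (\<tau> + 1) * (d as / as)"
        using as_pos by (simp add: divide_right_mono)
      then have "K * (R as / as) \<le> K * ((\<tau> + 1) * (d as / as))"
        using params by (intro mult_left_mono)
      then have "e as \<le> 0 + K * (\<tau> + 1) * (d as / as)"
        using R_lower[OF as_pos] by (simp add: mult.assoc)
      also have "\<dots> \<le> W * \<eta> * (d as / as) + K * (\<tau> + 1) * (d as / as)"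
        using params d_pos[OF as_pos(1)] as_pos by (intro add_right_mono) simp
      finally show ?thesis by (simp only: distrib_right)
    next
      case 2
      \<comment> \<open>At \<open>ah\<close> no discrepancy bound is available; instead, the
        definition of \<open>ah\<close> makes the noise term so large that it dominates the uniform
        bound \<open>W\<close> of the bias.\<close>
      then have "1 \<le> \<eta> * (d as / as)"
        using ah(2) as_pos by simp
      then have "W * 1 \<le> W * (\<eta> * (d as / as))"
        using params by (intro mult_left_mono)
      then have "e as \<le> W * \<eta> * (d as / as) + 0"
        using e_bound[OF as_pos(1)] by (simp add: mult.assoc)
      also have "\<dots> \<le> W * \<eta> * (d as / as) + K * (\<tau> + 1) * (d as / as)"
        using params d_pos[OF as_pos(1)] as_pos by (intro add_left_mono) simp
      finally show ?thesis by (simp only: distrib_right)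
    qed
    also have "\<dots> \<le> (W * \<eta> + K * (\<tau> + 1)) * ?\<Phi>"
      using params dq by (intro mult_left_mono) auto
    also have "\<dots> \<le> (1 + W * \<eta> + K * (\<tau> + 1)) * ?\<Phi>"
      using \<Phi>_pos by (intro mult_right_mono) auto
    finally show ?thesis .
  qed
  have "err as \<le> e as + c * (d as / as)"
    by (rule err[OF as])
  also have "\<dots> \<le> (1 + W * \<eta> + K * (\<tau> + 1)) * ?\<Phi>
      + c * ((1 + 1 / q + 1 / (q * (\<tau> - 1))) * ?\<Phi>)"
    using params by (intro add_mono bias mult_left_mono noise) auto
  finally show ?thesis
    by (simp only: distrib_right mult.assoc)
qed

end

section \<open>Quasi-optimality of the RG-rule\<close>

theorem theorem3p1:
  fixes T :: "'a::{real_inner,complete_space} \<Rightarrow> 'b::{real_inner,complete_space}"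
    and A :: "'a \<Rightarrow> 'a"
    and x0 xd :: 'a
    and g :: "real \<Rightarrow> real \<Rightarrow> real"
    and \<alpha>0 q \<tau> \<eta> c1 c2 t0 :: real
  assumes "compact_operator T"
    and "\<exists>x. T x \<noteq> 0"
    and "A = adjoint T \<circ> T"
    and "regularization (onorm A) g"
    and "0 < \<alpha>0" and "0 < q" and "q < 1" and "1 < \<tau>" and "0 < \<eta>"
    and "1 < c1" and "0 < c2" and "c2 < 1" and "0 < t0" and "t0 < onorm A"
    and "\<forall>\<alpha>. 0 < \<alpha> \<and> \<alpha> \<le> t0 \<longrightarrow>
           (LINT t:{0..<\<alpha>}|spectral_measure A (xd - x0). 1)
             \<le> c1\<^sup>2 * (LINT t:{c2 * \<alpha>..}|spectral_measure A (xd - x0). (residual g \<alpha> t)\<^sup>2)"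
  shows "\<exists>C::real. \<forall>\<delta> \<zeta> d.
           0 < \<delta> \<longrightarrow> noise_bound A q \<alpha>0 \<eta> \<delta> \<zeta> d \<longrightarrow>
           norm (reg_solution A g x0 (A xd + \<delta> *\<^sub>R \<zeta>)
                   (RG_parameter A g x0 (A xd + \<delta> *\<^sub>R \<zeta>) q \<alpha>0 \<tau> \<eta> d) - xd)
             \<le> C * (INF \<alpha>\<in>{0<..\<alpha>0}. norm (reg_solution A g x0 (A xd) \<alpha> - xd) + d \<alpha> / \<alpha>)"
proof -
  obtain \<gamma> where \<gamma>: "1 \<le> \<gamma>" "\<And>\<alpha> t. 0 < \<alpha> \<Longrightarrow> t \<in> {0..onorm A} \<Longrightarrow> \<alpha> * \<bar>g \<alpha> t\<bar> \<le> \<gamma>"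
    using assms(4) unfolding regularization_def by blast
  interpret spectral_regularization T A g \<gamma>
  proof
    have "bounded_linear T" using assms(1) by (simp add: compact_operator_def)
    then show "A x \<bullet> y = T x \<bullet> T y" for x y
      using adjoint_works_bounded_linear[of T y "T x"] by (simp add: assms(3) inner_commute)
  qed (use assms(1,4) \<gamma> in \<open>auto simp: regularization_def\<close>)
  define w where "w = xd - x0"
  define m where "m = c2 * min 1 (t0 / \<alpha>0)"
  define K where "K = sqrt (1 + c1\<^sup>2) * ((m + 1) / m)"
  \<comment> \<open>The constant of \<open>discrepancy_quasi_optimal\<close> with
    \<open>W = norm w\<close> and \<open>c = 2 * \<gamma>\<close>; it is fixed before \<delta>,
    \<zeta> and \<open>d\<close> are introduced.\<close>
  define C where "C = 1 + norm w * \<eta> + K * (\<tau> + 1) + (2 * \<gamma>) * (1 + 1 / q + 1 / (q * (\<tau> - 1)))"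
  have "m > 0" using assms(5,11,13) by (simp add: m_def)
  then have K: "0 \<le> K" by (simp add: K_def)
  then have C: "0 < C"
    unfolding C_def using assms(5-9) \<gamma>(1) by (intro add_pos_nonneg) auto
  show ?thesis
  proof (intro exI allI impI)
    fix \<delta> \<zeta> d assume \<delta>: "0 < \<delta>" and nb: "noise_bound A q \<alpha>0 \<eta> \<delta> \<zeta> d"
    interpret noise_level d
      using nb by unfold_locales (auto simp: noise_bound_def)
    let ?y = "A xd + \<delta> *\<^sub>R \<zeta>"
    let ?ah = "alpha_hat q \<alpha>0 \<eta> d"
    have grid_pos: "0 < \<alpha>" if "\<alpha> \<in> grid q \<alpha>0" for \<alpha>
      using that assms(5,6) by (auto simp: grid_def)
    have noise: "\<delta> * norm (fun_calc A (\<lambda>t. sqrt (s_fun \<alpha> t)) \<zeta>) \<le> d \<alpha>"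
      if "\<alpha> \<in> grid q \<alpha>0" "?ah \<le> \<alpha>" for \<alpha>
      using nb that by (auto simp: noise_bound_def)
    let ?E = "norm (reg_solution A g x0 ?y (RG_parameter A g x0 ?y q \<alpha>0 \<tau> \<eta> d) - xd)"
    have "?E \<le> C * (bias w \<alpha> + d \<alpha> / \<alpha>)" if "0 < \<alpha>" "\<alpha> \<le> \<alpha>0" for \<alpha>
      unfolding RG_parameter_def RG_admissible_def C_def
    proof (rule discrepancy_quasi_optimal[where R = "bias_discrepancy w"
          and err = "\<lambda>\<alpha>. norm (reg_solution A g x0 ?y \<alpha> - xd)"])
      show "bias w \<alpha> \<le> K * (bias_discrepancy w \<alpha> / \<alpha>)" if "0 < \<alpha>" "\<alpha> \<le> \<alpha>0" for \<alpha>
        unfolding K_def m_def w_def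
        by (rule bias_le_bias_discrepancy[OF assms(11-13) that assms(15)])
      show "0 \<le> bias w \<alpha>" for \<alpha> by (simp add: bias_def)
      show "norm (reg_solution A g x0 ?y \<alpha> - xd) \<le> bias w \<alpha> + 2 * \<gamma> * (d \<alpha> / \<alpha>)"
        if "\<alpha> \<in> grid q \<alpha>0" "?ah \<le> \<alpha>" for \<alpha>
        unfolding w_def by (rule total_error_le[OF grid_pos[OF that(1)] \<delta> noise[OF that]])
    qed (use assms(5-9) \<gamma>(1) K \<delta> grid_pos noise that in
        \<open>auto simp: w_def bias_mono bias_le_norm bias_discrepancy_le
           discrepancy_upper discrepancy_lower\<close>)
    \<comment> \<open>Dividing by the positive \<open>C\<close> turns the pointwise estimates into a
      lower bound for the set whose infimum is taken.\<close>
    then have "?E / C \<le> norm (reg_solution A g x0 (A xd) \<alpha> - xd) + d \<alpha> / \<alpha>" if "\<alpha> \<in> {0<..\<alpha>0}" for \<alpha>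
      using that C exact_error[of \<alpha> x0 xd] by (simp add: w_def pos_divide_le_eq mult.commute)
    then have "?E / C \<le> (INF \<alpha>\<in>{0<..\<alpha>0}. norm (reg_solution A g x0 (A xd) \<alpha> - xd) + d \<alpha> / \<alpha>)"
      using assms(5) by (intro cINF_greatest) auto
    then show "?E \<le> C * (INF \<alpha>\<in>{0<..\<alpha>0}. norm (reg_solution A g x0 (A xd) \<alpha> - xd) + d \<alpha> / \<alpha>)"
      using C by (simp add: field_simps)
  qed
qed

end
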